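(* Let $r\ge 2$ be a fixed integer and let $F_r$ be the free group of rank $r$. The probability that a random subgroup of $F_r$ of size $n$ (chosen uniformly among the finitely many subgroups of size $n$) is malnormal is $O(n^{-r/2})$ as $n\to\infty$.
   Context: Let $A$ be an alphabet with $r$ letters and $F_r=F(A)$. An $A$-graph is a pair $\Gamma=(V,E)$ with $E\subseteq V\times A\times V$ such that $(u,a,v),(u,a,v')\in E$ implies $v=v'$, and $(u,a,v),(u',a,v)\in E$ implies $u=u'$. It is connected if its underlying undirected graph is connected. A vertex is a leaf if it occurs at most once in the list of triples defining $E$. A pair $(\Gamma,1)$, with $1$ a distinguished vertex of $\Gamma$, is admissible if $\Gamma$ is a finite connected $A$-graph in which no vertex other than $1$ is a leaf. Each finitely generated subgroup $H$ of $F(A)$ corresponds to a unique (up to isomorphism) admissible pair $(\Gamma(H),1)$, its Stallings graph, such that a reduced word $u$ is in $H$ if and only if $u$ labels a loop at $1$ (an edge $(x,a,y)$ being read from $x$ to $y$ with label $a$ or from $y$ to $x$ with label $a^{-1}$); conversely every admissible pair is the Stallings graph of a unique finitely generated subgroup. The size of $H$ is the number of vertices of $\Gamma(H)$; there are finitely many subgroups of each size. A random subgroup of size $n$ is taken with respect to the uniform distribution on subgroups of size $n$ (the graph-based distribution). A subgroup $H$ is malnormal if $H\cap H^g=1$ for every $g\notin H$, where $H^g=g^{-1}Hg$. *)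

theory Defs
  imports
    "HOL-Algebra.Generated_Groups"
    "HOL-Probability.Probability_Mass_Function"
    "HOL-Library.Landau_Symbols"
begin

(* The letter (a, True) stands for the generator a and (a, False) for its formal inverse. *)
type_synonym 'a word = "('a \<times> bool) list"

fun letter_inv :: "'a \<times> bool \<Rightarrow> 'a \<times> bool" where
  "letter_inv (a, b) = (a, \<not> b)"

definition reduced :: "'a word \<Rightarrow> bool" where
  "reduced w \<longleftrightarrow> successively (\<lambda>x y. y \<noteq> letter_inv x) w"

fun red_cons :: "'a \<times> bool \<Rightarrow> 'a word \<Rightarrow> 'a word" where
  "red_cons x [] = [x]"
| "red_cons x (y # w) = (if y = letter_inv x then w else x # y # w)"

definition reduce :: "'a word \<Rightarrow> 'a word" where
  "reduce w = foldr red_cons w []"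

definition free_group :: "'a set \<Rightarrow> 'a word monoid" where
  "free_group A =
     \<lparr>carrier = {w. reduced w \<and> set w \<subseteq> A \<times> UNIV},
      monoid.mult = (\<lambda>u v. reduce (u @ v)),
      one = []\<rparr>"

lemma letter_inv_letter_inv [simp]: "letter_inv (letter_inv x) = x"
  by (cases x) simp

lemma letter_inv_eq_iff [simp]: "letter_inv x = letter_inv y \<longleftrightarrow> x = y"
  by (metis letter_inv_letter_inv)

lemma reduced_Nil [simp]: "reduced []"
  by (simp add: reduced_def)

lemma reduced_tail: "reduced (x # w) \<Longrightarrow> reduced w"
  by (cases w) (auto simp: reduced_def)

lemma reduced_red_cons: "reduced w \<Longrightarrow> reduced (red_cons x w)"
  by (cases w) (auto simp: reduced_def dest: reduced_tail[unfolded reduced_def])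

lemma red_cons_reduced: "reduced (x # w) \<Longrightarrow> red_cons x w = x # w"
  by (cases w) (auto simp: reduced_def)

lemma red_cons_cancel: "reduced w \<Longrightarrow> red_cons x (red_cons (letter_inv x) w) = w"
  by (cases w) (auto simp: red_cons_reduced)

lemma reduced_foldr: "reduced w \<Longrightarrow> reduced (foldr red_cons u w)"
  by (induction u) (auto intro: reduced_red_cons)

lemma reduced_reduce [simp]: "reduced (reduce w)"
  by (simp add: reduce_def reduced_foldr)

lemma reduce_reduced: "reduced w \<Longrightarrow> reduce w = w"
proof (induction w)
  case (Cons x w)
  then show ?case
    using reduced_tail[of x w] red_cons_reduced[of x w] by (simp add: reduce_def)
qed (simp add: reduce_def)

lemma reduce_append: "reduce (u @ v) = foldr red_cons u (reduce v)"
  by (simp add: reduce_def)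

lemma foldr_red_cons:
  assumes "reduced w"
  shows "foldr red_cons (red_cons x u) w = red_cons x (foldr red_cons u w)"
proof (cases u)
  case (Cons y v)
  then show ?thesis
    using assms by (auto simp: red_cons_cancel reduced_foldr)
qed simp

lemma foldr_reduce:
  assumes "reduced w"
  shows "foldr red_cons (reduce u) w = foldr red_cons u w"
  by (induction u) (auto simp: reduce_def foldr_red_cons assms)

lemma reduce_append_reduce:
  "reduce (reduce u @ v) = reduce (u @ v)" "reduce (u @ reduce v) = reduce (u @ v)"
  by (simp_all add: reduce_append foldr_reduce reduce_reduced)

lemma set_red_cons: "set (red_cons x w) \<subseteq> insert x (set w)"
  by (cases w) auto

lemma set_reduce: "set (reduce w) \<subseteq> set w"
  by (induction w) (use set_red_cons in \<open>fastforce simp: reduce_def\<close>)+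

lemma reduce_inverse: "reduce (map letter_inv (rev w) @ w) = []"
proof (induction w)
  case (Cons x w)
  have "reduce (map letter_inv (rev (x # w)) @ x # w) =
        foldr red_cons (map letter_inv (rev w)) (red_cons (letter_inv x) (red_cons x (reduce w)))"
    by (simp add: reduce_def)
  also have "red_cons (letter_inv x) (red_cons x (reduce w)) = reduce w"
    using red_cons_cancel[of "reduce w" "letter_inv x"] by simp
  finally show ?case
    using Cons by (simp add: reduce_append)
qed (simp add: reduce_def)

lemma group_free_group: "group (free_group A)"
proof (rule groupI)
  fix u v w
  assume "u \<in> carrier (free_group A)" "v \<in> carrier (free_group A)"
  then show "u \<otimes>\<^bsub>free_group A\<^esub> v \<in> carrier (free_group A)"
    using set_reduce[of "u @ v"] by (auto simp: free_group_def)
next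
  fix w
  assume w: "w \<in> carrier (free_group A)"
  define w' where "w' = reduce (map letter_inv (rev w))"
  have "w' \<otimes>\<^bsub>free_group A\<^esub> w = \<one>\<^bsub>free_group A\<^esub>"
    by (simp add: free_group_def w'_def reduce_append_reduce reduce_inverse)
  moreover have "w' \<in> carrier (free_group A)"
    using w set_reduce[of "map letter_inv (rev w)"] by (force simp: free_group_def w'_def)
  ultimately show "\<exists>y\<in>carrier (free_group A). y \<otimes>\<^bsub>free_group A\<^esub> w = \<one>\<^bsub>free_group A\<^esub>"
    by blast
qed (auto simp: free_group_def reduce_append_reduce reduce_reduced)

definition fin_gen_subgroup :: "('b, 'c) monoid_scheme \<Rightarrow> 'b set \<Rightarrow> bool" where
  "fin_gen_subgroup G H \<longleftrightarrow>
     subgroup H G \<and> (\<exists>S. finite S \<and> S \<subseteq> carrier G \<and> H = generate G S)"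

definition malnormal :: "('b, 'c) monoid_scheme \<Rightarrow> 'b set \<Rightarrow> bool" where
  "malnormal G H \<longleftrightarrow> subgroup H G \<and>
     (\<forall>g\<in>carrier G - H. H \<inter> (\<lambda>h. inv\<^bsub>G\<^esub> g \<otimes>\<^bsub>G\<^esub> h \<otimes>\<^bsub>G\<^esub> g) ` H = {\<one>\<^bsub>G\<^esub>})"

definition A_graph :: "'a set \<Rightarrow> 'v set \<Rightarrow> ('v \<times> 'a \<times> 'v) set \<Rightarrow> bool" where
  "A_graph A V E \<longleftrightarrow> E \<subseteq> V \<times> A \<times> V \<and>
     (\<forall>u a v v'. (u, a, v) \<in> E \<longrightarrow> (u, a, v') \<in> E \<longrightarrow> v = v') \<and>
     (\<forall>u u' a v. (u, a, v) \<in> E \<longrightarrow> (u', a, v) \<in> E \<longrightarrow> u = u')"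

definition connected_graph :: "'v set \<Rightarrow> ('v \<times> 'a \<times> 'v) set \<Rightarrow> bool" where
  "connected_graph V E \<longleftrightarrow>
     (\<forall>u\<in>V. \<forall>v\<in>V. (u, v) \<in> {(x, y). \<exists>a. (x, a, y) \<in> E \<or> (y, a, x) \<in> E}\<^sup>*)"

(* A loop (v, a, v) contributes two occurrences of v. *)
definition leaf :: "('v \<times> 'a \<times> 'v) set \<Rightarrow> 'v \<Rightarrow> bool" where
  "leaf E v \<longleftrightarrow> card {e \<in> E. fst e = v} + card {e \<in> E. snd (snd e) = v} \<le> 1"

definition admissible ::
    "'a set \<Rightarrow> 'v set \<Rightarrow> ('v \<times> 'a \<times> 'v) set \<Rightarrow> 'v \<Rightarrow> bool" where
  "admissible A V E p \<longleftrightarrow> finite V \<and> finite E \<and> A_graph A V E \<and> p \<in> V \<and>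
     connected_graph V E \<and> (\<forall>v\<in>V. v \<noteq> p \<longrightarrow> \<not> leaf E v)"

fun reads :: "('v \<times> 'a \<times> 'v) set \<Rightarrow> 'v \<Rightarrow> 'a word \<Rightarrow> 'v \<Rightarrow> bool" where
  "reads E u [] v \<longleftrightarrow> u = v"
| "reads E u ((a, b) # w) v \<longleftrightarrow>
     (\<exists>x. (if b then (u, a, x) \<in> E else (x, a, u) \<in> E) \<and> reads E x w v)"

definition stallings_graph ::
    "'a set \<Rightarrow> 'a word set \<Rightarrow> 'v set \<Rightarrow> ('v \<times> 'a \<times> 'v) set \<Rightarrow> 'v \<Rightarrow> bool" where
  "stallings_graph A H V E p \<longleftrightarrow> admissible A V E p \<and>
     (\<forall>u\<in>carrier (free_group A). u \<in> H \<longleftrightarrow> reads E p u p)"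

(* Stallings graphs are finite and determined only up to isomorphism, so it is no restriction
   to take their vertices in nat. *)
definition subgroups_of_size :: "'a set \<Rightarrow> nat \<Rightarrow> 'a word set set" where
  "subgroups_of_size A n =
     {H. fin_gen_subgroup (free_group A) H \<and>
         (\<exists>(V :: nat set) E p. stallings_graph A H V E p \<and> card V = n)}"

end

theory Submission
  imports Defs "HOL-Real_Asymp.Real_Asymp"
begin

text \<open>
  An \<open>A\<close>-graph on a fixed set of \<open>n\<close> vertices is a family of
  \<open>r\<close> partial injections, one for each letter. Malnormality of the subgroup
  \<open>H\<close> of the words labelling loops at the base point is a strong restriction on each
  of them separately. If a power of a letter labels loops at two different vertices, then
  \<open>H\<close> meets one of its conjugates by elements outside \<open>H\<close> in a
  nontrivial element (\<open>malnormal_power_loop_unique\<close>). Hence in the Stallings graph of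
  a malnormal subgroup the partial injection of every letter has no cycle, except possibly one
  fixed point (\<open>letter_rel_loop_only\<close>). Only a proportion \<open>O(n^(-1/2))\<close>
  of the partial injections is of this kind (\<open>card_loop_only_inj\<close>), and the letters
  being independent, the proportion for \<open>r\<close> letters is \<open>O(n^(-r/2))\<close>.

  The ratio \<open>n^(-1/2)\<close> comes from an exact count. The number of partial injections
  with \<open>n - j\<close> edges is \<open>n! C(n,j) / j!\<close> and at most \<open>n!
  C(n-1,j-1) / j!\<close> of these are acyclic; the quotient of the two numbers is
  \<open>j/n\<close>. So the proportion of acyclic ones is at most \<open>1/n\<close> times the
  mean number of points outside the domain of a random partial injection, and that mean is at most
  \<open>\<surd>n\<close> by an elementary second moment computation.

  Two points remain for passing from families of partial injections to subgroups. First, a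
  positive proportion of all families must be admissible. Already two letters achieve this: for a
  random pair of partial injections, the probability of being disconnected is
  \<open>O(1/n)\<close> and the probability of having a leaf is \<open>O(n^(-1/2))\<close>
  (\<open>card_bad_pairs\<close>). Adding edges for the other letters destroys neither
  connectedness nor the absence of leaves.

  Second, every subgroup of size \<open>n\<close> must come from the same number of graphs on
  \<open>{0..<n}\<close> with base point \<open>0\<close>, so that a uniform subgroup corresponds
  to a uniform labelled graph. This number is \<open>(n-1)!\<close>
  (\<open>card_labellings\<close>), because the Stallings graph is determined by the subgroup up
  to isomorphism (\<open>stallings_graph_unique\<close>) and a connected \<open>A\<close>-graph
  has no nontrivial automorphism fixing the base point (\<open>relabel_rigid\<close>).
\<close>

section \<open>Two sums governing the number of partial injections\<close>

text \<open>
  The value \<open>L\<^sub>n(-1)\<close> of a Laguerre polynomial; multiplied by \<open>n!\<close>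
  it counts the partial injections of an \<open>n\<close>-element set
  (\<open>card_partial_inj\<close>), the summand \<open>j\<close> being the contribution of those
  which are undefined at \<open>j\<close> points.
\<close>

definition pinj_ratio :: "nat \<Rightarrow> real" where
  "pinj_ratio n = (\<Sum>j\<le>n. real (n choose j) / fact j)"

text \<open>
  The analogous sum of Lah numbers, which bounds the number of acyclic partial injections divided
  by \<open>n!\<close> (\<open>card_acyclic_inj\<close>).
\<close>

definition acyclic_ratio :: "nat \<Rightarrow> real" where
  "acyclic_ratio n = (\<Sum>j=1..n. real ((n - 1) choose (j - 1)) / fact j)"

lemma pinj_ratio_pos: "pinj_ratio n > 0"
proof -
  have "(\<Sum>j\<in>{0}. real (n choose j) / fact j) \<le> pinj_ratio n"
    unfolding pinj_ratio_def by (rule sum_mono2) auto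
  then show ?thesis by simp
qed

lemma pinj_ratio_mono: "m \<le> n \<Longrightarrow> pinj_ratio m \<le> pinj_ratio n"
proof -
  assume mn: "m \<le> n"
  have "pinj_ratio m \<le> (\<Sum>j\<le>m. real (n choose j) / fact j)"
    unfolding pinj_ratio_def
    by (intro sum_mono divide_right_mono) (auto simp: mn binomial_right_mono)
  also have "\<dots> \<le> pinj_ratio n"
    unfolding pinj_ratio_def using mn by (intro sum_mono2) auto
  finally show ?thesis .
qed

lemma sum_le_exp: "x \<ge> 0 \<Longrightarrow> (\<Sum>j\<le>n. x ^ j / fact j) \<le> exp (x::real)"
proof -
  assume "x \<ge> 0"
  have "(\<Sum>j\<le>n. x ^ j / fact j) \<le> (\<Sum>j. x ^ j / fact j)"
    using \<open>x \<ge> 0\<close> summable_exp[of x]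
    by (intro sum_le_suminf) (auto simp: divide_inverse mult.commute)
  then show ?thesis by (simp add: exp_def divide_inverse mult.commute)
qed

text \<open>
  The summand \<open>C(n,j) / j!\<close> is at most the square of \<open>x^j / j!\<close> for
  \<open>x = \<surd>n\<close>, and a sum of squares of nonnegative numbers is at most the square
  of their sum, here at most \<open>(exp x)\<^sup>2\<close>.
\<close>

lemma pinj_ratio_le_exp: "pinj_ratio n \<le> exp (2 * sqrt n)"
proof -
  define a where "a j = sqrt n ^ j / fact j" for j
  have a0: "a j \<ge> 0" for j by (simp add: a_def)
  have "pinj_ratio n \<le> (\<Sum>j\<le>n. a j * a j)"
    unfolding pinj_ratio_def
  proof (rule sum_mono)
    fix j assume "j \<in> {..n}"
    have "real (n choose j) \<le> real n ^ j / fact j"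
    proof -
      have "real ((n choose j) * fact j) \<le> real (n ^ j)"
        using binomial_fact_pow[of n j] by (rule of_nat_mono)
      then show ?thesis by (simp add: pos_le_divide_eq)
    qed
    then have "real (n choose j) / fact j \<le> real n ^ j / fact j / fact j"
      by (intro divide_right_mono) auto
    also have "\<dots> = a j * a j"
      by (simp add: a_def power_mult_distrib[symmetric])
    finally show "real (n choose j) / fact j \<le> a j * a j" .
  qed
  also have "\<dots> \<le> (\<Sum>i\<le>n. \<Sum>j\<le>n. a i * a j)"
    by (intro sum_mono member_le_sum) (auto simp: a0)
  also have "\<dots> = (\<Sum>j\<le>n. a j) * (\<Sum>j\<le>n. a j)"
    by (simp add: sum_product)
  also have "\<dots> \<le> exp (sqrt n) * exp (sqrt n)"
    unfolding a_def by (intro mult_mono sum_le_exp sum_nonneg) auto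
  finally show ?thesis by (simp add: mult_exp_exp)
qed

text \<open>
  With \<open>t j = C(n,j) / j!\<close> we have \<open>j\<^sup>2 t j = (n - j + 1) t (j -
  1)\<close>, so the second moment of the distribution proportional to \<open>t\<close> is at most
  \<open>n\<close>.
\<close>

lemma second_moment_pinj_ratio: "(\<Sum>j\<le>n. real j ^ 2 * (real (n choose j) / fact j)) \<le> n * pinj_ratio n"
proof (cases n)
  case (Suc m)
  have "(\<Sum>j\<le>n. real j ^ 2 * (real (n choose j) / fact j)) =
        (\<Sum>j\<le>m. real (Suc j) ^ 2 * (real (n choose Suc j) / fact (Suc j)))"
    unfolding Suc by (subst sum.atMost_Suc_shift) simp
  also have "\<dots> \<le> (\<Sum>j\<le>m. n * (real (n choose j) / fact j))"
  proof (rule sum_mono)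
    fix j assume "j \<in> {..m}"
    have "real (Suc j) * real (n choose Suc j) = real (n - j) * real (n choose j)"
      using binomial_absorb_comp[of n j] binomial_absorption[of j n] by (metis of_nat_mult)
    moreover have "real (Suc j) ^ 2 * (real (n choose Suc j) / fact (Suc j)) =
        real (Suc j) * real (n choose Suc j) / fact j"
      by (simp add: power2_eq_square del: of_nat_Suc)
    ultimately have "real (Suc j) ^ 2 * (real (n choose Suc j) / fact (Suc j)) =
        real (n - j) * (real (n choose j) / fact j)"
      by simp
    also have "\<dots> \<le> n * (real (n choose j) / fact j)"
      by (intro mult_right_mono) auto
    finally show "real (Suc j) ^ 2 * (real (n choose Suc j) / fact (Suc j)) \<le> n * (real (n choose j) / fact j)" .
  qed
  also have "\<dots> \<le> n * pinj_ratio n"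
    unfolding pinj_ratio_def sum_distrib_left[symmetric] Suc
    by (intro mult_left_mono sum_mono2) auto
  finally show ?thesis .
qed (simp add: pinj_ratio_def)

text \<open>
  From the second moment, by \<open>2 j \<surd>n \<le> j\<^sup>2 + n\<close>. This is the source
  of the exponent \<open>1/2\<close> for each letter: a random partial injection is undefined at
  no more than \<open>\<surd>n\<close> points on average.
\<close>

lemma first_moment_pinj_ratio: "(\<Sum>j\<le>n. real j * (real (n choose j) / fact j)) \<le> sqrt n * pinj_ratio n"
proof (cases "n = 0")
  case False
  define t where "t j = real (n choose j) / fact j" for j
  have t0: "t j \<ge> 0" for j by (simp add: t_def)
  have s: "sqrt n > 0" using False by simp
  have "2 * sqrt n * (\<Sum>j\<le>n. real j * t j) = (\<Sum>j\<le>n. (2 * real j * sqrt n) * t j)"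
    by (simp add: sum_distrib_left mult_ac)
  also have "\<dots> \<le> (\<Sum>j\<le>n. (real j ^ 2 + n) * t j)"
  proof (intro sum_mono mult_right_mono t0)
    fix j
    show "2 * real j * sqrt n \<le> real j ^ 2 + n"
      using sum_squares_bound[of "real j" "sqrt n"] by simp
  qed
  also have "\<dots> = (\<Sum>j\<le>n. real j ^ 2 * t j) + n * pinj_ratio n"
    by (simp only: distrib_right sum.distrib pinj_ratio_def t_def sum_distrib_left)
  also have "\<dots> \<le> 2 * n * pinj_ratio n"
    using second_moment_pinj_ratio[of n] by (simp add: t_def)
  also have "\<dots> = 2 * sqrt n * (sqrt n * pinj_ratio n)" by simp
  finally show ?thesis using s by (simp add: t_def)
qed (simp add: pinj_ratio_def)

text \<open>
  Termwise, \<open>C(n-1,j-1) = (j/n) C(n,j)\<close>, which turns the sum into a first moment.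
\<close>

lemma acyclic_ratio_le: "n > 0 \<Longrightarrow> acyclic_ratio n \<le> pinj_ratio n / sqrt n"
proof -
  assume n: "n > 0"
  have "n * acyclic_ratio n = (\<Sum>j=1..n. real j * (real (n choose j) / fact j))"
    unfolding acyclic_ratio_def sum_distrib_left
  proof (rule sum.cong)
    fix j assume "j \<in> {1..n}"
    then have "n * ((n - 1) choose (j - 1)) = j * (n choose j)"
      using times_binomial_minus1_eq[of j n] by simp
    then have "real n * real ((n - 1) choose (j - 1)) = real j * real (n choose j)"
      by (metis of_nat_mult)
    then show "real n * (real ((n - 1) choose (j - 1)) / fact j) = real j * (real (n choose j) / fact j)"
      by (simp add: field_simps)
  qed simp
  also have "\<dots> \<le> (\<Sum>j\<le>n. real j * (real (n choose j) / fact j))"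
    by (rule sum_mono2) auto
  also have "\<dots> \<le> sqrt n * pinj_ratio n" by (rule first_moment_pinj_ratio)
  finally have "sqrt n * (sqrt n * acyclic_ratio n) \<le> sqrt n * pinj_ratio n" by (simp add: mult.assoc[symmetric])
  then have "sqrt n * acyclic_ratio n \<le> pinj_ratio n" using n by simp
  then show ?thesis using n by (simp add: field_simps)
qed

lemma acyclic_ratio_mono: "acyclic_ratio n \<le> acyclic_ratio (Suc n)"
proof -
  have "acyclic_ratio n \<le> (\<Sum>j=1..n. real (n choose (j - 1)) / fact j)"
    unfolding acyclic_ratio_def by (intro sum_mono divide_right_mono) (auto simp: binomial_right_mono)
  also have "\<dots> \<le> acyclic_ratio (Suc n)"
    unfolding acyclic_ratio_def diff_Suc_1 by (rule sum_mono2) auto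
  finally show ?thesis .
qed

section \<open>Counting partial injections\<close>

text \<open>
  Both sides count the pairs of a member of \<open>F\<close> with \<open>k + 1\<close> elements
  and one of its elements: the right-hand side records such a pair by the smaller set and the
  element to be added.
\<close>

lemma extension_double_count:
  assumes U: "finite U" and sub: "\<And>f. f \<in> F \<Longrightarrow> f \<subseteq> U"
    and del: "\<And>f e. f \<in> F \<Longrightarrow> f - {e} \<in> F"
  shows "Suc k * card {f\<in>F. card f = Suc k}
       = (\<Sum>g | g \<in> F \<and> card g = k. card {e. e \<notin> g \<and> insert e g \<in> F})"
proof -
  have finF: "finite F" using sub U by (meson Pow_iff finite_Pow_iff finite_subset subsetI)
  have finf: "finite f" if "f \<in> F" for f using sub[OF that] U by (rule finite_subset)
  define X where "X = (SIGMA f:{f\<in>F. card f = Suc k}. f)"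
  define Y where "Y = (SIGMA g:{g\<in>F. card g = k}. {e. e \<notin> g \<and> insert e g \<in> F})"
  have fe: "finite {e. e \<notin> g \<and> insert e g \<in> F}" for g
    by (rule finite_subset[OF _ U]) (use sub in blast)
  have "bij_betw (\<lambda>(f, e). (f - {e}, e)) X Y"
  proof (rule bij_betw_byWitness[where f' = "\<lambda>(g, e). (insert e g, e)"])
    show "(\<lambda>(f, e). (f - {e}, e)) ` X \<subseteq> Y"
      using del finf by (auto simp: X_def Y_def insert_absorb)
    show "(\<lambda>(g, e). (insert e g, e)) ` Y \<subseteq> X"
      using finf by (auto simp: X_def Y_def)
  qed (auto simp: X_def Y_def)
  then have "card X = card Y" by (rule bij_betw_same_card)
  moreover have "card X = Suc k * card {f\<in>F. card f = Suc k}"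
    unfolding X_def using finF finf by (subst card_SigmaI) auto
  moreover have "card Y = (\<Sum>g | g \<in> F \<and> card g = k. card {e. e \<notin> g \<and> insert e g \<in> F})"
    unfolding Y_def using finF fe by (subst card_SigmaI) auto
  ultimately show ?thesis by simp
qed

text \<open>
  Partial injections are represented by their graphs, because
  \<open>extension_double_count\<close> then applies to every family of them that is closed under
  removing edges.
\<close>

definition partial_inj :: "'v set \<Rightarrow> 'v rel set" where
  "partial_inj V = {f. f \<subseteq> V \<times> V \<and> single_valued f \<and> single_valued (f\<inverse>)}"

definition acyclic_inj :: "'v set \<Rightarrow> 'v rel set" where
  "acyclic_inj V = {f \<in> partial_inj V. acyclic f}"

lemma finite_partial_inj: "finite V \<Longrightarrow> finite (partial_inj V)"
  unfolding partial_inj_def by (rule finite_subset[of _ "Pow (V \<times> V)"]) auto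

lemma finite_acyclic_inj: "finite V \<Longrightarrow> finite (acyclic_inj V)"
  unfolding acyclic_inj_def by (simp add: finite_partial_inj)

lemma partial_inj_subset: "f \<in> partial_inj V \<Longrightarrow> g \<subseteq> f \<Longrightarrow> g \<in> partial_inj V"
  unfolding partial_inj_def by (auto simp: single_valued_def) blast+

lemma partial_inj_sub: "f \<in> partial_inj V \<Longrightarrow> f \<subseteq> V \<times> V"
  by (simp add: partial_inj_def)

lemma finite_partial_inj_elem: "finite V \<Longrightarrow> f \<in> partial_inj V \<Longrightarrow> finite f"
  using partial_inj_sub finite_subset by (metis finite_SigmaI)

lemma acyclic_inj_subset: "f \<in> acyclic_inj V \<Longrightarrow> g \<subseteq> f \<Longrightarrow> g \<in> acyclic_inj V"
  unfolding acyclic_inj_def by (auto intro: partial_inj_subset acyclic_subset)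

lemma card_Domain_partial_inj:
  assumes "f \<in> partial_inj V" shows "card (Domain f) = card f" "card (Range f) = card f"
proof -
  have "inj_on fst f" "inj_on snd f"
    using assms by (auto simp: partial_inj_def inj_on_def single_valued_def)
  then show "card (Domain f) = card f" "card (Range f) = card f"
    by (simp_all add: Domain_fst Range_snd card_image)
qed

lemma partial_inj_extensions:
  assumes "g \<in> partial_inj V"
  shows "{e. e \<notin> g \<and> insert e g \<in> partial_inj V} = (V - Domain g) \<times> (V - Range g)"
proof (intro equalityI subsetI)
  fix e assume e: "e \<in> {e. e \<notin> g \<and> insert e g \<in> partial_inj V}"
  obtain t u where tu: "e = (t, u)" by (cases e)
  have sv: "single_valued (insert e g)" "single_valued ((insert e g)\<inverse>)" "t \<in> V" "u \<in> V"
    using e by (auto simp: partial_inj_def tu)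
  have "t \<notin> Domain g"
  proof
    assume "t \<in> Domain g"
    then obtain x where "(t, x) \<in> g" by blast
    then show False using single_valuedD[OF sv(1), of t x u] e by (auto simp: tu)
  qed
  moreover have "u \<notin> Range g"
  proof
    assume "u \<in> Range g"
    then obtain x where "(x, u) \<in> g" by blast
    then show False using single_valuedD[OF sv(2), of u x t] e by (auto simp: tu)
  qed
  ultimately show "e \<in> (V - Domain g) \<times> (V - Range g)" using sv by (simp add: tu)
next
  fix e assume "e \<in> (V - Domain g) \<times> (V - Range g)"
  then obtain t u where tu: "e = (t, u)" and "t \<in> V" "t \<notin> Domain g" "u \<in> V" "u \<notin> Range g" by blast
  moreover have "single_valued (insert (t, u) g)" "single_valued ((insert (t, u) g)\<inverse>)"
    using assms calculation by (auto simp: partial_inj_def single_valued_def)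
  ultimately show "e \<in> {e. e \<notin> g \<and> insert e g \<in> partial_inj V}"
    using assms by (auto simp: partial_inj_def)
qed

lemma card_extensions:
  assumes "finite V" "g \<in> partial_inj V"
  shows "card (V - Domain g) = card V - card g" "card (V - Range g) = card V - card g"
    "card g \<le> card V"
proof -
  have "Domain g \<subseteq> V" "Range g \<subseteq> V" using assms by (auto simp: partial_inj_def)
  then show "card (V - Domain g) = card V - card g" "card (V - Range g) = card V - card g"
     "card g \<le> card V"
    using assms card_Domain_partial_inj[OF assms(2)]
    by (auto simp: card_Diff_subset finite_subset) (metis card_mono)
qed

lemma fact_div_shift:
  assumes "k < n"
  shows "fact n / fact (n - Suc k) = real (n - k) * (fact n / fact (n - k) :: real)"
proof -
  have "n - k = Suc (n - Suc k)" using assms by simp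
  then have "fact (n - k) = real (n - k) * fact (n - Suc k)" by (metis fact_Suc)
  then show ?thesis using assms by simp
qed

lemma card_partial_inj_edges:
  assumes V: "finite V" "card V = n"
  shows "k \<le> n \<Longrightarrow> real (card {f\<in>partial_inj V. card f = k}) = real (n choose k) * (fact n / fact (n - k))"
proof (induction k)
  case 0
  have "{f\<in>partial_inj V. card f = 0} = {{}}"
  proof (intro equalityI subsetI)
    fix f assume "f \<in> {f\<in>partial_inj V. card f = 0}"
    then show "f \<in> {{}}" using finite_partial_inj_elem[OF V(1), of f] by auto
  qed (simp add: partial_inj_def)
  then show ?case by simp
next
  case (Suc k)
  let ?P = "partial_inj V"
  have "Suc k * card {f\<in>?P. card f = Suc k} =
      (\<Sum>g | g \<in> ?P \<and> card g = k. card {e. e \<notin> g \<and> insert e g \<in> ?P})"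
    using V by (intro extension_double_count[of "V \<times> V"] finite_SigmaI partial_inj_sub
      partial_inj_subset[OF _ Diff_subset])
  also have "\<dots> = (\<Sum>g | g \<in> ?P \<and> card g = k. (n - k) * (n - k))"
  proof (rule sum.cong[OF refl])
    fix g assume "g \<in> {g \<in> ?P. card g = k}"
    then show "card {e. e \<notin> g \<and> insert e g \<in> ?P} = (n - k) * (n - k)"
      using V card_extensions[OF V(1), of g]
      by (simp only: partial_inj_extensions card_cartesian_product mem_Collect_eq)
  qed
  also have "\<dots> = card {g\<in>?P. card g = k} * ((n - k) * (n - k))" by simp
  finally have "real (Suc k * card {f\<in>?P. card f = Suc k}) =
      real (card {g\<in>?P. card g = k} * ((n - k) * (n - k)))"
    by (rule arg_cong)
  then have "real (Suc k) * real (card {f\<in>?P. card f = Suc k}) =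
      real (card {g\<in>?P. card g = k}) * (real (n - k) * real (n - k))"
    by (simp only: of_nat_mult)
  also have "\<dots> = (real (n - k) * real (n choose k)) * (real (n - k) * (fact n / fact (n - k)))"
    using Suc.IH Suc.prems by (simp del: of_nat_diff)
  also have "real (n - k) * (fact n / fact (n - k)) = fact n / fact (n - Suc k)"
    using Suc.prems by (intro fact_div_shift[symmetric]) simp
  also have "real (n - k) * real (n choose k) = real (Suc k) * real (n choose Suc k)"
    using binomial_absorb_comp[of n k] binomial_absorption[of k n] by (metis of_nat_mult)
  finally have "real (Suc k) * real (card {f\<in>?P. card f = Suc k}) =
     real (Suc k) * (real (n choose Suc k) * (fact n / fact (n - Suc k)))"
    by (simp only: mult.assoc)
  then show ?case by (rule mult_left_cancel[OF of_nat_neq_0, THEN iffD1])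
qed

text \<open>
  Following edges backwards from \<open>t\<close> terminates.
\<close>

lemma path_start:
  assumes "finite g" "acyclic g"
  shows "\<exists>s. s \<notin> Range g \<and> (s, t) \<in> g\<^sup>*"
proof -
  have "wf g" using assms by (rule finite_acyclic_wf)
  then show ?thesis
  proof (induction t)
    case (less t)
    then show ?case by (cases "t \<in> Range g") (auto, metis rtrancl_into_rtrancl)
  qed
qed

text \<open>
  An added edge must lead from one of the \<open>n - k\<close> points outside the domain to one of
  the \<open>n - k\<close> points outside the range, and not to the start of the path that it
  comes from, since this would close a cycle.
\<close>

lemma card_acyclic_extensions:
  assumes V: "finite V" "card V = n" and g: "g \<in> acyclic_inj V" "card g = k"
  shows "card {e. e \<notin> g \<and> insert e g \<in> acyclic_inj V} \<le> (n - k) * (n - k - 1)"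
proof -
  have gp: "g \<in> partial_inj V" "acyclic g" using g by (auto simp: acyclic_inj_def)
  have "finite g" using gp V finite_partial_inj_elem by blast
  then have "\<forall>t. \<exists>s. s \<notin> Range g \<and> (s, t) \<in> g\<^sup>*"
    using path_start[of g] gp(2) by blast
  from choice[OF this] obtain s where s: "s t \<notin> Range g" "(s t, t) \<in> g\<^sup>*" for t by blast
  have sV: "s t \<in> V" if "t \<in> V" for t
    using s(2)[of t] that gp(1) by (cases rule: converse_rtranclE) (auto simp: partial_inj_def)
  have "{e. e \<notin> g \<and> insert e g \<in> acyclic_inj V} \<subseteq>
      (SIGMA t:V - Domain g. V - Range g - {s t})"
  proof
    fix e assume "e \<in> {e. e \<notin> g \<and> insert e g \<in> acyclic_inj V}"
    then have e: "e \<notin> g" "insert e g \<in> partial_inj V" "acyclic (insert e g)"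
      by (auto simp: acyclic_inj_def)
    obtain t u where tu: "e = (t, u)" by (cases e)
    have "(t, u) \<in> (V - Domain g) \<times> (V - Range g)"
      unfolding partial_inj_extensions[OF gp(1), symmetric] tu[symmetric] using e by simp
    moreover have "u \<noteq> s t"
      using e(3) s(2)[of t] by (auto simp: tu)
    ultimately show "e \<in> (SIGMA t:V - Domain g. V - Range g - {s t})" by (auto simp: tu)
  qed
  then have "card {e. e \<notin> g \<and> insert e g \<in> acyclic_inj V} \<le>
      card (SIGMA t:V - Domain g. V - Range g - {s t})"
    using V by (intro card_mono) auto
  also have "\<dots> = (\<Sum>t\<in>V - Domain g. n - k - 1)"
    using V g sV s gp by (subst card_SigmaI) (auto intro!: sum.cong simp: card_Diff_subset card_extensions)
  also have "\<dots> = (n - k) * (n - k - 1)"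
    using V g gp by (simp add: card_extensions)
  finally show ?thesis .
qed

text \<open>
  Compared with \<open>card_partial_inj_edges\<close>, one of the two factors \<open>n - k\<close>
  of the recursion is replaced by \<open>n - k - 1\<close>.
\<close>

lemma card_acyclic_inj_edges:
  assumes V: "finite V" "card V = n"
  shows "k < n \<Longrightarrow> real (card {f\<in>acyclic_inj V. card f = k})
     \<le> real ((n - 1) choose k) * (fact n / fact (n - k))"
proof (induction k)
  case 0
  have sub: "{f\<in>acyclic_inj V. card f = 0} \<subseteq> {{}}"
  proof
    fix f assume "f \<in> {f\<in>acyclic_inj V. card f = 0}"
    then show "f \<in> {{}}" using finite_partial_inj_elem[OF V(1), of f] by (auto simp: acyclic_inj_def)
  qed
  have "card {f\<in>acyclic_inj V. card f = 0} \<le> 1" using card_mono[OF _ sub] by simp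
  then show ?case by simp
next
  case (Suc k)
  let ?P = "acyclic_inj V"
  have "Suc k * card {f\<in>?P. card f = Suc k} =
      (\<Sum>g | g \<in> ?P \<and> card g = k. card {e. e \<notin> g \<and> insert e g \<in> ?P})"
  proof (rule extension_double_count[of "V \<times> V"])
    show "f \<subseteq> V \<times> V" if "f \<in> ?P" for f
      using that partial_inj_sub by (auto simp: acyclic_inj_def)
    show "f - {e} \<in> ?P" if "f \<in> ?P" for f e
      using that by (rule acyclic_inj_subset) blast
  qed (use V in auto)
  also have "\<dots> \<le> (\<Sum>g | g \<in> ?P \<and> card g = k. (n - k) * (n - k - 1))"
    using card_acyclic_extensions[OF V] by (intro sum_mono) blast
  also have "\<dots> = card {g\<in>?P. card g = k} * ((n - k) * (n - k - 1))" by simp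
  finally have "real (Suc k * card {f\<in>?P. card f = Suc k}) \<le>
      real (card {g\<in>?P. card g = k} * ((n - k) * (n - k - 1)))"
    by (rule of_nat_mono)
  then have "real (Suc k) * real (card {f\<in>?P. card f = Suc k}) \<le>
      real (card {g\<in>?P. card g = k}) * (real (n - k) * real (n - k - 1))"
    by (simp only: of_nat_mult)
  also have "\<dots> \<le> (real ((n - 1) choose k) * (fact n / fact (n - k))) * (real (n - k) * real (n - k - 1))"
    using Suc by (intro mult_right_mono) auto
  also have "\<dots> = (real (n - 1 - k) * real ((n - 1) choose k)) * (real (n - k) * (fact n / fact (n - k)))"
    by (simp add: diff_commute)
  also have "real (n - k) * (fact n / fact (n - k)) = fact n / fact (n - Suc k)"
    using Suc.prems by (intro fact_div_shift[symmetric]) simp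
  also have "real (n - 1 - k) * real ((n - 1) choose k) = real (Suc k) * real ((n - 1) choose Suc k)"
    using binomial_absorb_comp[of "n - 1" k] binomial_absorption[of k "n - 1"] by (metis of_nat_mult)
  finally have "real (Suc k) * real (card {f\<in>?P. card f = Suc k}) \<le>
     real (Suc k) * (real ((n - 1) choose Suc k) * (fact n / fact (n - Suc k)))"
    by (simp only: mult.assoc)
  then show ?case by (simp only: mult_le_cancel_left_pos of_nat_0_less_iff zero_less_Suc)
qed

lemma sum_by_edges:
  assumes V: "finite V" "card V = n" and F: "F \<subseteq> partial_inj V"
  shows "(\<Sum>f\<in>F. h (card f)) = (\<Sum>k\<le>n. real (card {f\<in>F. card f = k}) * h k :: real)"
proof -
  have "finite F" using F finite_partial_inj V finite_subset by blast
  then have "(\<Sum>f\<in>F. h (card f)) = (\<Sum>k\<le>n. \<Sum>f | f \<in> F \<and> card f = k. h (card f))"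
    using F V card_extensions(3)[of V] by (subst sum.group[of F "{..n}" card]) auto
  also have "\<dots> = (\<Sum>k\<le>n. real (card {f\<in>F. card f = k}) * h k)"
    by (intro sum.cong) auto
  finally show ?thesis .
qed

lemma sum_reflect: "(\<Sum>k\<le>(n::nat). h k :: real) = (\<Sum>j\<le>n. h (n - j))"
  using sum.nat_diff_reindex[of h "Suc n"] by (simp add: lessThan_Suc_atMost)

lemma card_partial_inj:
  assumes V: "finite V" "card V = n"
  shows "real (card (partial_inj V)) = fact n * pinj_ratio n"
proof -
  have "real (card (partial_inj V)) = (\<Sum>f\<in>partial_inj V. (\<lambda>k. 1) (card f))" by simp
  also have "\<dots> = (\<Sum>k\<le>n. real (n choose k) * (fact n / fact (n - k)))"
    using V by (subst sum_by_edges[OF V]) (auto simp: card_partial_inj_edges)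
  also have "\<dots> = (\<Sum>j\<le>n. real (n choose (n - j)) * (fact n / fact (n - (n - j))))"
    by (rule sum_reflect)
  also have "\<dots> = fact n * pinj_ratio n"
    unfolding pinj_ratio_def sum_distrib_left
  proof (rule sum.cong[OF refl])
    fix j assume "j \<in> {..n}"
    then show "real (n choose (n - j)) * (fact n / fact (n - (n - j))) = fact n * (real (n choose j) / fact j)"
      using binomial_symmetric[of j n] by simp
  qed
  finally show ?thesis .
qed

lemma card_acyclic_inj:
  assumes V: "finite V" "card V = n" and n: "n > 0"
  shows "real (card (acyclic_inj V)) \<le> fact n * acyclic_ratio n"
proof -
  have ac: "acyclic_inj V \<subseteq> partial_inj V" by (auto simp: acyclic_inj_def)
  \<comment> \<open>The bound by edges covers fewer than n edges; with n edges no point is outside the range, so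
    no path can start.\<close>
  have full: "{f\<in>acyclic_inj V. card f = n} = {}"
  proof (rule ccontr)
    assume "{f\<in>acyclic_inj V. card f = n} \<noteq> {}"
    then obtain f where f: "f \<in> partial_inj V" "acyclic f" "card f = n" by (auto simp: acyclic_inj_def)
    then have "finite f" using V finite_partial_inj_elem by blast
    obtain v where v: "v \<in> V" using V n by fastforce
    obtain s where s: "s \<notin> Range f" "(s, v) \<in> f\<^sup>*" using path_start[OF \<open>finite f\<close> f(2), of v] by blast
    have "s \<in> V" using s(2) v f(1) by (cases rule: converse_rtranclE) (auto simp: partial_inj_def)
    moreover have "card (V - Range f) = 0" using card_extensions(2)[OF V(1) f(1)] f V by simp
    ultimately show False using V s(1) by auto
  qed
  have "real (card (acyclic_inj V)) = (\<Sum>f\<in>acyclic_inj V. (\<lambda>k. 1) (card f))" by simp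
  also have "\<dots> = (\<Sum>k\<le>n. real (card {f\<in>acyclic_inj V. card f = k}))"
    using V by (subst sum_by_edges[OF V ac]) auto
  also have "\<dots> \<le> (\<Sum>k\<le>n. if k = n then 0 else real ((n - 1) choose k) * (fact n / fact (n - k)))"
  proof (rule sum_mono)
    fix k assume "k \<in> {..n}"
    then show "real (card {f\<in>acyclic_inj V. card f = k}) \<le>
        (if k = n then 0 else real ((n - 1) choose k) * (fact n / fact (n - k)))"
      using card_acyclic_inj_edges[OF V, of k] by (cases "k = n") (simp_all add: full)
  qed
  also have "\<dots> = (\<Sum>j\<le>n. if j = 0 then 0 else real ((n - 1) choose (n - j)) * (fact n / fact j))"
    by (subst sum_reflect, rule sum.cong) auto
  also have "\<dots> = (\<Sum>j\<in>{1..n}. real ((n - 1) choose (n - j)) * (fact n / fact j))"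
    by (intro sum.mono_neutral_cong_right) auto
  also have "\<dots> = fact n * acyclic_ratio n"
    unfolding acyclic_ratio_def sum_distrib_left
  proof (rule sum.cong)
    fix j assume j: "j \<in> {1..n}"
    then have "(n - 1) choose (n - j) = (n - 1) choose (j - 1)"
      using binomial_symmetric[of "j - 1" "n - 1"] by (simp add: diff_le_mono)
    then show "real ((n - 1) choose (n - j)) * (fact n / fact j) = fact n * (real ((n - 1) choose (j - 1)) / fact j)"
      by simp
  qed simp
  finally show ?thesis .
qed

section \<open>Pairs of partial injections\<close>

text \<open>
  The acyclic partial injections, and those whose only cycle is a single fixed point. These are
  the possible actions of a letter on the Stallings graph of a malnormal subgroup: a generator can
  itself be conjugate into such a subgroup, so one fixed point has to be permitted.
\<close>

definition loop_only_inj :: "'v set \<Rightarrow> 'v rel set" where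
  "loop_only_inj V = acyclic_inj V \<union> (\<Union>v\<in>V. insert (v, v) ` acyclic_inj (V - {v}))"

text \<open>
  Choosing the fixed point costs a factor \<open>n\<close>, which is compensated because the rest
  is an acyclic partial injection of only \<open>n - 1\<close> points.
\<close>

lemma card_loop_only_inj:
  assumes V: "finite V" "card V = n" and n: "n \<ge> 2"
  shows "real (card (loop_only_inj V)) \<le> 2 / sqrt n * real (card (partial_inj V))"
proof -
  have part: "real (card (insert (v, v) ` acyclic_inj (V - {v}))) \<le> fact (n - 1) * acyclic_ratio (n - 1)"
    if "v \<in> V" for v
  proof -
    have "card (insert (v, v) ` acyclic_inj (V - {v})) \<le> card (acyclic_inj (V - {v}))"
      using V by (intro card_image_le finite_acyclic_inj) auto
    moreover have "real (card (acyclic_inj (V - {v}))) \<le> fact (n - 1) * acyclic_ratio (n - 1)"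
      using V n that by (intro card_acyclic_inj) auto
    ultimately show ?thesis by linarith
  qed
  have "card (loop_only_inj V) \<le> card (acyclic_inj V) + card (\<Union>v\<in>V. insert (v, v) ` acyclic_inj (V - {v}))"
    unfolding loop_only_inj_def by (rule card_Un_le)
  also have "\<dots> \<le> card (acyclic_inj V) + (\<Sum>v\<in>V. card (insert (v, v) ` acyclic_inj (V - {v})))"
    using V by (intro add_left_mono card_UN_le)
  finally have "real (card (loop_only_inj V)) \<le>
      real (card (acyclic_inj V) + (\<Sum>v\<in>V. card (insert (v, v) ` acyclic_inj (V - {v}))))"
    by (rule of_nat_mono)
  also have "\<dots> = real (card (acyclic_inj V)) + (\<Sum>v\<in>V. real (card (insert (v, v) ` acyclic_inj (V - {v}))))"
    by simp
  also have "\<dots> \<le> fact n * acyclic_ratio n + (\<Sum>v\<in>V. fact (n - 1) * acyclic_ratio (n - 1))"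
    using card_acyclic_inj[OF V] n part by (intro add_mono sum_mono) auto
  also have "\<dots> = fact n * (acyclic_ratio n + acyclic_ratio (n - 1))"
    using V n fact_reduce[of n, where 'a = real] by (simp add: distrib_left)
  also have "\<dots> \<le> fact n * (pinj_ratio n / sqrt n + pinj_ratio n / sqrt n)"
    using acyclic_ratio_mono[of "n - 1"] acyclic_ratio_le[of n] n by (intro mult_left_mono add_mono) auto
  also have "\<dots> = 2 / sqrt n * real (card (partial_inj V))"
    by (simp add: card_partial_inj[OF V])
  finally show ?thesis .
qed

definition respects_cut :: "'v set \<Rightarrow> 'v set \<Rightarrow> 'v rel \<Rightarrow> bool" where
  "respects_cut V S f \<longleftrightarrow> f \<subseteq> S \<times> S \<union> (V - S) \<times> (V - S)"

text \<open>
  A partial injection respecting the cut splits into one on each side. In the resulting product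
  \<open>k! (n-k)! pinj_ratio k * pinj_ratio (n-k)\<close> the last factor is estimated by its
  value at \<open>n\<close>.
\<close>

lemma card_respects_cut:
  assumes V: "finite V" "card V = n" and S: "S \<subseteq> V" "card S = k"
  shows "real (card {f\<in>partial_inj V. respects_cut V S f})
    \<le> real (card (partial_inj V)) * pinj_ratio k / real (n choose k)"
proof -
  have k: "k \<le> n" using V S card_mono by blast
  have fS: "finite S" using V S finite_subset by blast
  let ?h = "\<lambda>f. (f \<inter> S \<times> S, f \<inter> (V - S) \<times> (V - S))"
  let ?X = "{f\<in>partial_inj V. respects_cut V S f}"
  have "inj_on ?h ?X"
    unfolding inj_on_def respects_cut_def by blast
  moreover have "?h ` ?X \<subseteq> partial_inj S \<times> partial_inj (V - S)"
  proof
    fix y assume "y \<in> ?h ` ?X"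
    then obtain f where f: "f \<in> partial_inj V" "y = ?h f" by blast
    have "f \<inter> S \<times> S \<in> partial_inj V" "f \<inter> (V - S) \<times> (V - S) \<in> partial_inj V"
      using f(1) by (auto elim!: partial_inj_subset)
    then show "y \<in> partial_inj S \<times> partial_inj (V - S)"
      unfolding f(2) partial_inj_def by simp
  qed
  ultimately have "card ?X \<le> card (partial_inj S \<times> partial_inj (V - S))"
    using V fS by (intro card_inj_on_le finite_cartesian_product finite_partial_inj) auto
  then have "real (card ?X) \<le> real (card (partial_inj S)) * real (card (partial_inj (V - S)))"
    by (simp add: card_cartesian_product flip: of_nat_mult)
  also have "\<dots> = (fact k * pinj_ratio k) * (fact (n - k) * pinj_ratio (n - k))"
    using V S fS by (subst (1 2) card_partial_inj) (auto simp: card_Diff_subset)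
  also have "\<dots> = (fact k * fact (n - k)) * pinj_ratio k * pinj_ratio (n - k)" by simp
  also have "fact k * fact (n - k) = fact n / real (n choose k)"
    using binomial_fact[OF k, where 'a = real] by simp
  also have "fact n / real (n choose k) * pinj_ratio k * pinj_ratio (n - k) \<le> fact n / real (n choose k) * pinj_ratio k * pinj_ratio n"
    using pinj_ratio_pos[of k] by (intro mult_left_mono pinj_ratio_mono) (auto intro!: mult_nonneg_nonneg)
  also have "\<dots> = real (card (partial_inj V)) * pinj_ratio k / real (n choose k)"
    by (simp add: card_partial_inj[OF V])
  finally show ?thesis .
qed

text \<open>
  Both the factor \<open>n\<close> and the exponential growth in \<open>k\<close> matter: the
  first makes the probability of disconnectedness small, the second makes the sum over
  \<open>k\<close> converge. The trick is to extract the factor \<open>n / k\<close> by absorption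
  before estimating the rest by \<open>(n/k)^k\<close>.
\<close>

lemma binomial_ge_linear:
  assumes k: "1 \<le> k" "2 * k \<le> n"
  shows "real (n choose k) \<ge> real n * 2 ^ (k - 1) / real k"
proof -
  have "real (k * (n choose k)) = real (n * ((n - 1) choose (k - 1)))"
    using k times_binomial_minus1_eq[of k n] by simp
  moreover have "(2::real) ^ (k - 1) \<le> real ((n - 1) choose (k - 1))"
  proof (cases "k = 1")
    case False
    have "(2::real) ^ (k - 1) \<le> (real (n - 1) / real (k - 1)) ^ (k - 1)"
      using k False by (intro power_mono) (auto simp: field_simps of_nat_diff)
    also have "\<dots> \<le> real ((n - 1) choose (k - 1))"
      using k by (intro binomial_ge_n_over_k_pow_k) auto
    finally show ?thesis .
  qed simp
  then have "real n * 2 ^ (k - 1) \<le> real n * real ((n - 1) choose (k - 1))"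
    by (rule mult_left_mono) simp
  ultimately show ?thesis using k by (simp add: field_simps)
qed

text \<open>
  A bound, up to the factor \<open>1/n\<close>, for the expected number of sets of
  \<open>k\<close> vertices that are disconnected from the rest in a random pair of partial
  injections, for \<open>k\<close> at most \<open>n/2\<close>.
\<close>

definition cut_weight :: "nat \<Rightarrow> real" where
  "cut_weight k = exp (4 * sqrt k) * real k / 2 ^ (k - 1)"

lemma cut_weight_nonneg: "cut_weight k \<ge> 0" by (simp add: cut_weight_def)

lemma summable_cut_weight: "summable cut_weight"
proof -
  have "(\<lambda>k. exp (4 * sqrt (real (Suc k))) * real (Suc k) / 2 ^ k) \<in> O(\<lambda>k. inverse (real k ^ 2))"
    by real_asymp
  then have bigo: "(\<lambda>k. cut_weight (Suc k)) \<in> O(\<lambda>k. inverse (real k ^ 2))"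
    by (simp add: cut_weight_def)
  have sq: "summable (\<lambda>k. inverse (real k ^ 2))"
    by (rule inverse_power_summable[OF order_refl])
  have "summable (\<lambda>k. norm (inverse (real k ^ 2)))"
    by (rule summable_cong[THEN iffD1, OF _ sq]) simp
  from summable_comparison_test_bigo[OF this bigo] show ?thesis
    by (rule summable_Suc_iff[THEN iffD1])
qed

lemma cut_weight_bound:
  assumes k: "1 \<le> k" "2 * k \<le> n"
  shows "pinj_ratio k ^ 2 / real (n choose k) \<le> cut_weight k / n"
proof -
  have n: "n > 0" using k by simp
  have "pinj_ratio k ^ 2 \<le> exp (2 * sqrt k) ^ 2"
    using pinj_ratio_pos[of k] by (intro power_mono pinj_ratio_le_exp) auto
  also have "\<dots> = exp (4 * sqrt k)"
    by (simp add: power2_eq_square mult_exp_exp)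
  finally have "pinj_ratio k ^ 2 / real (n choose k) \<le> exp (4 * sqrt k) / (real n * 2 ^ (k - 1) / real k)"
    using k n binomial_ge_linear[OF k] by (intro frac_le) auto
  also have "\<dots> = cut_weight k / n" by (simp add: cut_weight_def)
  finally show ?thesis .
qed

definition cut_pairs :: "'v set \<Rightarrow> ('v rel \<times> 'v rel) set" where
  "cut_pairs V = {(f, g). f \<in> partial_inj V \<and> g \<in> partial_inj V \<and>
     (\<exists>S. S \<subseteq> V \<and> S \<noteq> {} \<and> S \<noteq> V \<and> respects_cut V S f \<and> respects_cut V S g)}"

text \<open>
  Union bound over the smaller side of the cut. Since \<open>f\<close> and \<open>g\<close> must
  both respect it, the \<open>C(n,k)\<close> choices of the side are compensated by the square of
  \<open>1 / C(n,k)\<close>.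
\<close>

lemma card_cut_pairs:
  assumes V: "finite V" "card V = n"
  shows "real (card (cut_pairs V)) \<le> suminf cut_weight / n * real (card (partial_inj V)) ^ 2"
proof -
  define X where "X S = {f\<in>partial_inj V. respects_cut V S f}" for S
  define T where "T k = {S. S \<subseteq> V \<and> card S = k}" for k
  let ?I = "real (card (partial_inj V))"
  have "cut_pairs V \<subseteq> (\<Union>k\<in>{1..n div 2}. \<Union>S\<in>T k. X S \<times> X S)"
  proof
    fix z assume "z \<in> cut_pairs V"
    then obtain f g S where z: "z = (f, g)" "f \<in> partial_inj V" "g \<in> partial_inj V"
      and S: "S \<subseteq> V" "S \<noteq> {}" "S \<noteq> V" "respects_cut V S f" "respects_cut V S g"
      by (auto simp: cut_pairs_def)
    define S' where "S' = (if 2 * card S \<le> n then S else V - S)"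
    have "finite S" using S V finite_subset by blast
    then have "card (V - S) = n - card S" using V S by (simp add: card_Diff_subset)
    moreover have "respects_cut V (V - S) f" "respects_cut V (V - S) g"
      using S unfolding respects_cut_def by blast+
    moreover have "V - S \<noteq> {}" using S by blast
    ultimately have S': "S' \<subseteq> V" "S' \<noteq> {}" "2 * card S' \<le> n" "respects_cut V S' f" "respects_cut V S' g"
      using S by (auto simp: S'_def)
    moreover have "finite S'" using S' V finite_subset by blast
    ultimately have "card S' \<in> {1..n div 2}" using card_gt_0_iff[of S'] by (simp add: Suc_le_eq)
    moreover have "S' \<in> T (card S')" using S' by (simp add: T_def)
    moreover have "z \<in> X S' \<times> X S'" using z S' by (simp add: X_def)
    ultimately show "z \<in> (\<Union>k\<in>{1..n div 2}. \<Union>S\<in>T k. X S \<times> X S)" by blast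
  qed
  moreover have fT: "finite (T k)" for k using V by (simp add: T_def)
  moreover have "finite (X S)" for S using V by (simp add: X_def finite_partial_inj)
  ultimately have "card (cut_pairs V) \<le> card (\<Union>k\<in>{1..n div 2}. \<Union>S\<in>T k. X S \<times> X S)"
    by (intro card_mono) auto
  also have "\<dots> \<le> (\<Sum>k\<in>{1..n div 2}. card (\<Union>S\<in>T k. X S \<times> X S))"
    by (intro card_UN_le) simp
  also have "\<dots> \<le> (\<Sum>k\<in>{1..n div 2}. \<Sum>S\<in>T k. card (X S \<times> X S))"
    by (intro sum_mono card_UN_le fT)
  finally have "real (card (cut_pairs V)) \<le> real (\<Sum>k\<in>{1..n div 2}. \<Sum>S\<in>T k. card (X S \<times> X S))"
    by (rule of_nat_mono)
  also have "\<dots> = (\<Sum>k\<in>{1..n div 2}. \<Sum>S\<in>T k. real (card (X S)) ^ 2)"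
    by (simp add: card_cartesian_product power2_eq_square)
  also have "\<dots> \<le> (\<Sum>k\<in>{1..n div 2}. \<Sum>S\<in>T k. (?I * pinj_ratio k / real (n choose k)) ^ 2)"
    using V card_respects_cut[OF V] by (intro sum_mono power_mono) (auto simp: X_def T_def)
  also have "\<dots> = (\<Sum>k\<in>{1..n div 2}. ?I ^ 2 * (pinj_ratio k ^ 2 / real (n choose k)))"
  proof (rule sum.cong[OF refl])
    fix k assume "k \<in> {1..n div 2}"
    then have "k \<le> n" by (meson atLeastAtMost_iff div_le_dividend order_trans)
    then have "n choose k > 0" by simp
    moreover have "card (T k) = n choose k" using n_subsets[OF V(1), of k] V by (simp add: T_def)
    ultimately show "(\<Sum>S\<in>T k. (?I * pinj_ratio k / real (n choose k)) ^ 2) = ?I ^ 2 * (pinj_ratio k ^ 2 / real (n choose k))"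
      by (simp add: power2_eq_square field_simps)
  qed
  also have "\<dots> \<le> (\<Sum>k\<in>{1..n div 2}. ?I ^ 2 * (cut_weight k / n))"
    by (intro sum_mono mult_left_mono cut_weight_bound) auto
  also have "\<dots> = ?I ^ 2 / n * sum cut_weight {1..n div 2}"
    by (simp add: sum_distrib_left)
  also have "\<dots> \<le> ?I ^ 2 / n * suminf cut_weight"
    by (intro mult_left_mono sum_le_suminf summable_cut_weight cut_weight_nonneg) auto
  finally show ?thesis by (simp add: mult_ac)
qed

text \<open>
  Exchanging the order of summation, both sums are the total number of undefined points of all
  partial injections, which is a first moment.
\<close>

lemma sum_card_missing:
  assumes V: "finite V" "card V = n"
  shows "(\<Sum>v\<in>V. real (card {g\<in>partial_inj V. v \<notin> Domain g})) \<le> sqrt n * real (card (partial_inj V))"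
    and "(\<Sum>v\<in>V. real (card {g\<in>partial_inj V. v \<notin> Range g})) \<le> sqrt n * real (card (partial_inj V))"
proof -
  let ?P = "partial_inj V"
  have fin: "finite ?P" using V by (simp add: finite_partial_inj)
  have swap: "(\<Sum>v\<in>V. real (card {g\<in>?P. v \<notin> D g})) = (\<Sum>g\<in>?P. real (card (V - D g)))" for D :: "'a rel \<Rightarrow> 'a set"
  proof -
    have "(\<Sum>v\<in>V. real (card {g\<in>?P. v \<notin> D g})) = (\<Sum>v\<in>V. \<Sum>g\<in>?P. if v \<notin> D g then 1 else 0)"
      using fin by (intro sum.cong) (auto simp: sum.If_cases Int_def)
    also have "\<dots> = (\<Sum>g\<in>?P. \<Sum>v\<in>V. if v \<notin> D g then 1 else 0)" by (rule sum.swap)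
    also have "\<dots> = (\<Sum>g\<in>?P. real (card (V - D g)))"
      using V by (intro sum.cong) (auto simp: sum.If_cases set_diff_eq Int_def)
    finally show ?thesis .
  qed
  have val: "(\<Sum>g\<in>?P. real (n - card g)) \<le> sqrt n * real (card ?P)"
  proof -
    have "(\<Sum>g\<in>?P. real (n - card g)) = (\<Sum>k\<le>n. real (card {f\<in>?P. card f = k}) * real (n - k))"
      by (rule sum_by_edges[OF V, of ?P "\<lambda>k. real (n - k)"]) simp
    also have "\<dots> = (\<Sum>k\<le>n. real (n choose k) * (fact n / fact (n - k)) * real (n - k))"
      using card_partial_inj_edges[OF V] by (intro sum.cong) auto
    also have "\<dots> = (\<Sum>j\<le>n. real (n choose (n - j)) * (fact n / fact (n - (n - j))) * real (n - (n - j)))"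
      by (rule sum_reflect)
    also have "\<dots> = fact n * (\<Sum>j\<le>n. real j * (real (n choose j) / fact j))"
      unfolding sum_distrib_left
    proof (rule sum.cong[OF refl])
      fix j assume "j \<in> {..n}"
      then show "real (n choose (n - j)) * (fact n / fact (n - (n - j))) * real (n - (n - j)) =
          fact n * (real j * (real (n choose j) / fact j))"
        using binomial_symmetric[of j n] by simp
    qed
    also have "\<dots> \<le> fact n * (sqrt n * pinj_ratio n)"
      by (intro mult_left_mono first_moment_pinj_ratio) simp
    also have "\<dots> = sqrt n * real (card ?P)" by (simp add: card_partial_inj[OF V])
    finally show ?thesis .
  qed
  show "(\<Sum>v\<in>V. real (card {g\<in>?P. v \<notin> Domain g})) \<le> sqrt n * real (card ?P)"
    unfolding swap using val card_extensions(1)[OF V(1)] V by simp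
  show "(\<Sum>v\<in>V. real (card {g\<in>?P. v \<notin> Range g})) \<le> sqrt n * real (card ?P)"
    unfolding swap using val card_extensions(2)[OF V(1)] V by simp
qed

text \<open>
  If \<open>v\<close> is a leaf for the pair, then it is met by at most one edge, counted with
  multiplicity: so it is isolated in one of \<open>f\<close>, \<open>g\<close> and lies outside
  the domain or outside the range of the other. The case that it is isolated in \<open>g\<close>
  is covered by the converse relation in \<open>bad_pairs\<close>.
\<close>

definition isolated_pairs :: "'v set \<Rightarrow> ('v rel \<times> 'v rel) set" where
  "isolated_pairs V = {(f, g). f \<in> partial_inj V \<and> g \<in> partial_inj V \<and>
     (\<exists>v\<in>V. v \<notin> Field f \<and> (v \<notin> Domain g \<or> v \<notin> Range g))}"

text \<open>
  A point is isolated in \<open>f\<close> with probability at most \<open>1/n\<close>. This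
  cancels the sum over the points, and the second requirement contributes
  \<open>O(n^(-1/2))\<close> on average.
\<close>

lemma card_isolated_pairs:
  assumes V: "finite V" "card V = n" and n: "n > 0"
  shows "real (card (isolated_pairs V)) \<le> 2 / sqrt n * real (card (partial_inj V)) ^ 2"
proof -
  let ?P = "partial_inj V" and ?I = "real (card (partial_inj V))"
  let ?D = "\<lambda>v. {g\<in>?P. v \<notin> Domain g}" and ?R = "\<lambda>v. {g\<in>?P. v \<notin> Range g}"
  have fin: "finite ?P" "\<And>v. finite (partial_inj (V - {v}))" using V by (simp_all add: finite_partial_inj)
  have "isolated_pairs V \<subseteq> (\<Union>v\<in>V. partial_inj (V - {v}) \<times> (?D v \<union> ?R v))"
    by (auto simp: isolated_pairs_def partial_inj_def Field_def)
  then have "card (isolated_pairs V) \<le> card (\<Union>v\<in>V. partial_inj (V - {v}) \<times> (?D v \<union> ?R v))"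
    using V fin by (intro card_mono) auto
  also have "\<dots> \<le> (\<Sum>v\<in>V. card (partial_inj (V - {v}) \<times> (?D v \<union> ?R v)))"
    using V by (intro card_UN_le)
  also have "\<dots> \<le> (\<Sum>v\<in>V. card (partial_inj (V - {v})) * (card (?D v) + card (?R v)))"
    by (intro sum_mono) (simp add: card_cartesian_product card_Un_le)
  finally have "real (card (isolated_pairs V)) \<le> real (\<Sum>v\<in>V. card (partial_inj (V - {v})) * (card (?D v) + card (?R v)))"
    by (rule of_nat_mono)
  also have "\<dots> = (\<Sum>v\<in>V. (fact (n - 1) * pinj_ratio (n - 1)) * (real (card (?D v)) + real (card (?R v))))"
    using V by (simp add: card_partial_inj)
  also have "\<dots> = (fact (n - 1) * pinj_ratio (n - 1)) * ((\<Sum>v\<in>V. real (card (?D v))) + (\<Sum>v\<in>V. real (card (?R v))))"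
    by (simp only: sum_distrib_left[symmetric] sum.distrib)
  also have "\<dots> \<le> (fact (n - 1) * pinj_ratio n) * (sqrt n * ?I + sqrt n * ?I)"
    using pinj_ratio_pos[of n] pinj_ratio_pos[of "n - 1"] by (intro mult_mono add_mono sum_card_missing V pinj_ratio_mono) (auto intro!: sum_nonneg add_nonneg_nonneg mult_nonneg_nonneg)
  also have "\<dots> = 2 / sqrt n * (fact n * pinj_ratio n) * ?I"
  proof -
    have f: "fact n = sqrt n * (sqrt n * fact (n - 1))"
      using n fact_reduce[of n, where 'a = real] by (simp add: mult.assoc[symmetric])
    have "2 / sqrt n * (sqrt n * (sqrt n * fact (n - 1)) * pinj_ratio n) * ?I =
        (fact (n - 1) * pinj_ratio n) * (sqrt n * ?I + sqrt n * ?I)" using n by simp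
    then show ?thesis unfolding f by (rule sym)
  qed
  also have "\<dots> = 2 / sqrt n * ?I ^ 2"
    by (simp add: card_partial_inj[OF V] power2_eq_square)
  finally show ?thesis .
qed

definition bad_pairs :: "'v set \<Rightarrow> ('v rel \<times> 'v rel) set" where
  "bad_pairs V = cut_pairs V \<union> isolated_pairs V \<union> (isolated_pairs V)\<inverse>"

lemma card_bad_pairs:
  "\<forall>\<^sub>F n in sequentially. real (card (bad_pairs {..<n})) \<le> real (card (partial_inj {..<n})) ^ 2 / 2"
proof -
  have "(\<lambda>n. suminf cut_weight / real n + 4 / sqrt (real n)) \<longlonglongrightarrow> 0"
  proof -
    have "(\<lambda>n. 4 / sqrt (real n)) \<longlonglongrightarrow> 0" by real_asymp
    from tendsto_add[OF lim_const_over_n this] show ?thesis by simp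
  qed
  then have "\<forall>\<^sub>F n in sequentially. suminf cut_weight / real n + 4 / sqrt (real n) < 1 / 2"
    by (rule order_tendstoD(2)) simp
  moreover have "\<forall>\<^sub>F n::nat in sequentially. n > 0" by (rule eventually_gt_at_top)
  ultimately show ?thesis
  proof eventually_elim
    case (elim n)
    let ?V = "{..<n}" and ?I = "real (card (partial_inj {..<n})) ^ 2"
    have "card (bad_pairs ?V) \<le> card (cut_pairs ?V) + card (isolated_pairs ?V) + card ((isolated_pairs ?V)\<inverse>)"
      unfolding bad_pairs_def by (rule order_trans[OF card_Un_le add_right_mono[OF card_Un_le]])
    then have "real (card (bad_pairs ?V)) \<le> real (card (cut_pairs ?V)) + 2 * real (card (isolated_pairs ?V))"
      unfolding card_inverse by linarith
    also have "\<dots> \<le> suminf cut_weight / n * ?I + 2 * (2 / sqrt n * ?I)"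
      using elim by (intro add_mono mult_left_mono card_cut_pairs card_isolated_pairs) auto
    also have "\<dots> = (suminf cut_weight / n + 4 / sqrt n) * ?I" by (simp add: algebra_simps)
    also have "\<dots> \<le> 1 / 2 * ?I" using elim(1) by (intro mult_right_mono) auto
    finally show ?case by (simp only: mult_1 times_divide_eq_left)
  qed
qed

section \<open>Reading words in a graph; the group of loops\<close>

abbreviation winv :: "'a word \<Rightarrow> 'a word" where
  "winv w \<equiv> map letter_inv (rev w)"

lemma reads_append: "reads E u (w @ w') v \<longleftrightarrow> (\<exists>x. reads E u w x \<and> reads E x w' v)"
  by (induction E u w v rule: reads.induct) auto

lemma reads_letter_inv: "reads E u [letter_inv x] v \<longleftrightarrow> reads E v [x] u"
  by (cases x) auto

lemma reads_Cons: "reads E u (x # w) v \<longleftrightarrow> (\<exists>y. reads E u [x] y \<and> reads E y w v)"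
  using reads_append[of E u "[x]" w v] by simp

lemma reads_winv: "reads E u (winv w) v \<longleftrightarrow> reads E v w u"
proof (induction w arbitrary: v)
  case (Cons x w)
  then show ?case
    unfolding list.map rev.simps map_append reads_append reads_letter_inv reads_Cons[of E v x w] by blast
qed auto

lemma reads_unique:
  assumes "A_graph A V E" "reads E u w v" "reads E u w v'"
  shows "v = v'"
  using assms(2,3)
proof (induction w arbitrary: u)
  case (Cons x w)
  obtain a b where x: "x = (a, b)" by (cases x)
  obtain y y' where y: "reads E u [x] y" "reads E y w v" "reads E u [x] y'" "reads E y' w v'"
    using Cons.prems reads_Cons[of E u x w] by metis
  have "y = y'" using y(1,3) assms(1) unfolding A_graph_def x by (cases b) simp_all
  then show ?case using Cons.IH y by blast
qed simp

lemma reads_red_cons: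
  assumes G: "A_graph A V E" and r: "reads E u (x # w) v"
  shows "reads E u (red_cons x w) v"
proof (cases "\<exists>w'. w = letter_inv x # w'")
  case True
  then obtain w' where w: "w = letter_inv x # w'" by blast
  obtain y z where yz: "reads E u [x] y" "reads E y [letter_inv x] z" "reads E z w' v"
    using r unfolding w reads_Cons[of E _ x "_ # _"] reads_Cons[of E _ "letter_inv x" w'] by blast
  have "reads E y [letter_inv x] u" using yz(1) by (simp only: reads_letter_inv)
  then have "z = u" using reads_unique[OF G yz(2)] by simp
  then show ?thesis using yz(3) by (simp add: w)
next
  case False
  then have "red_cons x w = x # w" by (cases w) auto
  then show ?thesis using r by simp
qed

text \<open>
  Because a graph is deterministic in both directions, reading \<open>x\<close> and then its
  inverse leads back to the start.
\<close>

lemma reads_reduce: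
  assumes G: "A_graph A V E"
  shows "reads E u w v \<Longrightarrow> reads E u (reduce w) v"
proof (induction w arbitrary: u)
  case (Cons x w)
  obtain y where "reads E u [x] y" "reads E y w v" using Cons.prems reads_Cons[of E u x w v] by blast
  then have "reads E u (x # reduce w) v" using Cons.IH reads_Cons[of E u x "reduce w" v] by blast
  then have "reads E u (red_cons x (reduce w)) v" by (rule reads_red_cons[OF G])
  then show ?case by (simp add: reduce_def)
qed (simp add: reduce_def)

lemma reads_letters: "A_graph A V E \<Longrightarrow> reads E u w v \<Longrightarrow> set w \<subseteq> A \<times> UNIV"
proof (induction w arbitrary: u)
  case (Cons x w)
  obtain y where y: "reads E u [x] y" "reads E y w v" using Cons.prems reads_Cons[of E u x w v] by blast
  have "fst x \<in> A" using y(1) Cons.prems(1) by (cases x) (auto simp: A_graph_def split: if_splits)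
  then show ?case using Cons.IH[OF Cons.prems(1) y(2)] by (cases x) auto
qed simp

lemma reads_in_V: "A_graph A V E \<Longrightarrow> reads E u w v \<Longrightarrow> u \<in> V \<Longrightarrow> v \<in> V"
proof (induction w arbitrary: u)
  case (Cons x w)
  obtain y where y: "reads E u [x] y" "reads E y w v" using Cons.prems reads_Cons[of E u x w v] by blast
  have "y \<in> V" using y(1) Cons.prems(1) by (cases x) (auto simp: A_graph_def split: if_splits)
  then show ?case using Cons.IH Cons.prems(1) y(2) by blast
qed simp

lemma carrier_free_group: "w \<in> carrier (free_group A) \<longleftrightarrow> reduced w \<and> set w \<subseteq> A \<times> UNIV"
  by (simp add: free_group_def)

lemma mult_free_group [simp]: "u \<otimes>\<^bsub>free_group A\<^esub> v = reduce (u @ v)"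
  by (simp add: free_group_def)

lemma one_free_group [simp]: "\<one>\<^bsub>free_group A\<^esub> = []"
  by (simp add: free_group_def)

lemma reduce_in_carrier: "set w \<subseteq> A \<times> UNIV \<Longrightarrow> reduce w \<in> carrier (free_group A)"
  using set_reduce[of w] by (auto simp: carrier_free_group)

lemma set_winv: "set w \<subseteq> A \<times> UNIV \<Longrightarrow> set (winv w) \<subseteq> A \<times> UNIV"
  by auto

lemma reduce_winv_cancel: "reduce (u @ winv w @ w @ v) = reduce (u @ v)"
  by (metis append.assoc append_Nil reduce_append_reduce(1,2) reduce_inverse)

lemma winv_winv [simp]: "winv (winv w) = w"
  by (simp add: rev_map comp_def)

lemma reduce_cancel_winv: "reduce (u @ w @ winv w @ v) = reduce (u @ v)"
  using reduce_winv_cancel[of u "winv w" v] by (simp only: winv_winv)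

lemma inv_free_group:
  assumes "w \<in> carrier (free_group A)"
  shows "inv\<^bsub>free_group A\<^esub> w = reduce (winv w)"
proof (rule group.inv_equality[OF group_free_group])
  show "reduce (winv w) \<otimes>\<^bsub>free_group A\<^esub> w = \<one>\<^bsub>free_group A\<^esub>"
    by (simp add: reduce_append_reduce reduce_inverse)
  have "set w \<subseteq> A \<times> UNIV" using assms by (simp add: carrier_free_group)
  then show "reduce (winv w) \<in> carrier (free_group A)" by (intro reduce_in_carrier set_winv)
qed (rule assms)

definition loop_group :: "'a set \<Rightarrow> ('v \<times> 'a \<times> 'v) set \<Rightarrow> 'v \<Rightarrow> 'a word set" where
  "loop_group A E p = {w \<in> carrier (free_group A). reads E p w p}"

lemma reduce_in_loop_group:
  assumes "A_graph A V E" "reads E p w p"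
  shows "reduce w \<in> loop_group A E p"
  using reduce_in_carrier[OF reads_letters[OF assms]] reads_reduce[OF assms]
  by (simp add: loop_group_def)

lemma subgroup_loop_group:
  assumes G: "A_graph A V E"
  shows "subgroup (loop_group A E p) (free_group A)"
proof (rule group.subgroupI[OF group_free_group])
  show "loop_group A E p \<subseteq> carrier (free_group A)" by (auto simp: loop_group_def)
  have "[] \<in> loop_group A E p" by (simp add: loop_group_def carrier_free_group)
  then show "loop_group A E p \<noteq> {}" by blast
next
  fix w assume w: "w \<in> loop_group A E p"
  then have "reads E p (winv w) p" unfolding reads_winv by (simp add: loop_group_def)
  then show "inv\<^bsub>free_group A\<^esub> w \<in> loop_group A E p"
    using w reduce_in_loop_group[OF G] by (simp add: loop_group_def inv_free_group)
next
  fix u v assume "u \<in> loop_group A E p" "v \<in> loop_group A E p"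
  then have "reads E p (u @ v) p" unfolding reads_append by (auto simp: loop_group_def)
  then show "u \<otimes>\<^bsub>free_group A\<^esub> v \<in> loop_group A E p"
    using reduce_in_loop_group[OF G] by simp
qed

lemma connected_reads:
  assumes "connected_graph V E" "p \<in> V" "v \<in> V"
  shows "\<exists>w. reads E p w v"
proof -
  have "(p, v) \<in> {(x, y). \<exists>a. (x, a, y) \<in> E \<or> (y, a, x) \<in> E}\<^sup>*"
    using assms by (auto simp: connected_graph_def)
  then show ?thesis
  proof (induction rule: rtrancl_induct)
    case base
    show ?case by (rule exI[of _ "[]"]) simp
  next
    case (step y z)
    then obtain w a where w: "reads E p w y" "(y, a, z) \<in> E \<or> (z, a, y) \<in> E" by blast
    then have "reads E p (w @ [(a, True)]) z \<or> reads E p (w @ [(a, False)]) z"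
      unfolding reads_append by auto
    then show ?case by blast
  qed
qed

lemma finite_directed_edges:
  assumes "finite E" shows "finite {(u, x, v). reads E u [x] v}"
proof (rule finite_subset)
  show "{(u, x, v). reads E u [x] v} \<subseteq>
    (\<lambda>(u, a, v). (u, (a, True), v)) ` E \<union> (\<lambda>(u, a, v). (v, (a, False), u)) ` E"
    by (force split: if_splits)
qed (use assms in auto)

text \<open>
  Schreier generators: choose a word \<open>t v\<close> from the base point to each vertex
  \<open>v\<close>. A loop read through the vertices \<open>u\<^sub>0, u\<^sub>1, \<dots>\<close>
  is the product of the finitely many elements obtained from its edges by going out along
  \<open>t\<close>, over the edge, and back along the inverse of \<open>t\<close>.
\<close>

lemma fin_gen_loop_group:
  assumes adm: "admissible A V E p"
  shows "fin_gen_subgroup (free_group A) (loop_group A E p)"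
proof -
  have G: "A_graph A V E" and p: "p \<in> V" and E: "finite E" and conn: "connected_graph V E"
    using adm by (auto simp: admissible_def)
  have "\<forall>v\<in>V. \<exists>w. reads E p w v" using connected_reads[OF conn p] by blast
  from bchoice[OF this] obtain t where t: "reads E p (t v) v" if "v \<in> V" for v by blast
  define c where "c u w v = reduce (t u @ w @ winv (t v))" for u w v
  define S where "S = (\<lambda>(u, x, v). c u [x] v) ` {(u, x, v). reads E u [x] v}"
  let ?g = "generate (free_group A) S" and ?H = "loop_group A E p"
  have edge_V: "u \<in> V \<and> v \<in> V" if "reads E u [x] v" for u x v
    using that G by (cases x) (auto simp: A_graph_def split: if_splits)
  have c_in: "c u w v \<in> ?H" if "u \<in> V" "reads E u w v" for u w v
  proof -
    have "v \<in> V" using reads_in_V[OF G that(2,1)] .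
    then have "reads E p (t u @ w @ winv (t v)) p"
      unfolding reads_append reads_winv using t that by blast
    then show ?thesis unfolding c_def by (rule reduce_in_loop_group[OF G])
  qed
  have S: "S \<subseteq> ?H" unfolding S_def using edge_V c_in by auto
  have sub: "subgroup ?H (free_group A)" by (rule subgroup_loop_group[OF G])
  have gen: "c u w v \<in> ?g" if "u \<in> V" "reads E u w v" for u w v
    using that
  proof (induction w arbitrary: u)
    case Nil
    have "c u [] v = []" using Nil reduce_cancel_winv[of "[]" "t v" "[]"] by (simp add: c_def reduce_def)
    then show ?case using generate.one[of "free_group A" S] by simp
  next
    case (Cons x w)
    obtain y where y: "reads E u [x] y" "reads E y w v" using Cons.prems reads_Cons[of E u x w v] by blast
    have "c u [x] y \<in> S" unfolding S_def using y(1) by (intro image_eqI[where x = "(u, x, y)"]) simp_all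
    then have 1: "c u [x] y \<in> ?g" by (rule generate.incl)
    have "y \<in> V" using y(1) edge_V by blast
    then have 2: "c y w v \<in> ?g" using Cons.IH y by blast
    have "c u [x] y \<otimes>\<^bsub>free_group A\<^esub> c y w v = c u (x # w) v"
      using reduce_winv_cancel[of "t u @ [x]" "t y" "w @ winv (t v)"]
      by (simp add: c_def reduce_append_reduce)
    then show ?case using generate.eng[OF 1 2] by simp
  qed
  have "?H \<subseteq> ?g"
  proof
    fix w assume w: "w \<in> ?H"
    have tp: "reads E p (t p) p" using t p by blast
    have "reads E p (winv (t p) @ w @ t p) p"
      unfolding reads_append reads_winv using w tp by (auto simp: loop_group_def)
    then have "c p (winv (t p) @ w @ t p) p \<in> ?g" by (intro gen p)
    moreover have "c p (winv (t p) @ w @ t p) p = w"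
      using reduce_cancel_winv[of "[]" "t p" "w @ t p @ winv (t p)"] reduce_cancel_winv[of w "t p" "[]"] w
      by (simp add: c_def loop_group_def carrier_free_group reduce_reduced)
    ultimately show "w \<in> ?g" by simp
  qed
  moreover have "?g \<subseteq> ?H" using group.generate_subgroup_incl[OF group_free_group S sub] .
  moreover have "finite S" unfolding S_def using finite_directed_edges[OF E] by (rule finite_imageI)
  moreover have "S \<subseteq> carrier (free_group A)" using S by (auto simp: loop_group_def)
  ultimately show ?thesis unfolding fin_gen_subgroup_def using sub by blast
qed

text \<open>
  Directed edges \<open>(u, x, v)\<close>, where \<open>x\<close> may be an inverse letter, are
  consecutive if they can follow each other in a reduced word.
\<close>

definition nonbacktracking :: "('v \<times> 'a \<times> 'v) set \<Rightarrow> ('v \<times> ('a \<times> bool) \<times> 'v) rel" where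
  "nonbacktracking E = {((u, x, v), (v', y, w)). v' = v \<and> y \<noteq> letter_inv x \<and> reads E u [x] v \<and> reads E v [y] w}"

fun flip :: "'v \<times> ('a \<times> bool) \<times> 'v \<Rightarrow> 'v \<times> ('a \<times> bool) \<times> 'v" where
  "flip (u, x, v) = (v, letter_inv x, u)"

lemma nonbacktracking_flip: "(d, e) \<in> nonbacktracking E \<Longrightarrow> (flip e, flip d) \<in> nonbacktracking E"
proof -
  assume "(d, e) \<in> nonbacktracking E"
  then obtain u x v y w where de: "d = (u, x, v)" "e = (v, y, w)"
    "y \<noteq> letter_inv x" "reads E u [x] v" "reads E v [y] w"
    by (cases d; cases e) (auto simp: nonbacktracking_def)
  then show ?thesis
    unfolding nonbacktracking_def de flip.simps mem_Collect_eq case_prod_conv reads_letter_inv by auto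
qed

lemma nonbacktracking_rtrancl_flip: "(d, e) \<in> (nonbacktracking E)\<^sup>* \<Longrightarrow> (flip e, flip d) \<in> (nonbacktracking E)\<^sup>*"
  by (induction rule: rtrancl_induct) (auto intro: converse_rtrancl_into_rtrancl nonbacktracking_flip)

lemma card_le_1I:
  assumes "\<And>x y. x \<in> S \<Longrightarrow> y \<in> S \<Longrightarrow> x = y"
  shows "card S \<le> 1"
proof (cases "S = {}")
  case False
  then obtain x where "x \<in> S" by blast
  then have "S = {x}" using assms by blast
  then show ?thesis by simp
qed simp

lemma nonbacktracking_step:
  assumes G: "A_graph A V E" and nl: "\<not> leaf E v" and r: "reads E u [x] v"
  shows "\<exists>e. ((u, x, v), e) \<in> nonbacktracking E"
proof (rule ccontr)
  assume no: "\<nexists>e. ((u, x, v), e) \<in> nonbacktracking E"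
  have only: "y = letter_inv x" if "reads E v [y] w" for y w
    using no r that unfolding nonbacktracking_def by blast
  let ?O = "{e \<in> E. fst e = v}" and ?I = "{e \<in> E. snd (snd e) = v}"
  have O: "letter_inv x = (a, True)" if "(v, a, w) \<in> E" for a w
    by (rule only[symmetric, of _ w]) (simp add: that)
  have I: "letter_inv x = (a, False)" if "(w, a, v) \<in> E" for a w
    by (rule only[symmetric, of _ w]) (simp add: that)
  have det: "w = w'" if "(v, a, w) \<in> E" "(v, a, w') \<in> E" for a w w'
    using G that unfolding A_graph_def by blast
  have codet: "w = w'" if "(w, a, v) \<in> E" "(w', a, v) \<in> E" for a w w'
    using G that unfolding A_graph_def by blast
  have cO: "card ?O \<le> 1"
  proof (rule card_le_1I)
    fix e e' assume "e \<in> ?O" "e' \<in> ?O"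
    then obtain a w a' w' where e: "e = (v, a, w)" "e' = (v, a', w')" "(v, a, w) \<in> E" "(v, a', w') \<in> E"
      by (cases e; cases e') auto
    then have "a = a'" using O[OF e(3)] O[OF e(4)] by simp
    then show "e = e'" using det e by blast
  qed
  have cI: "card ?I \<le> 1"
  proof (rule card_le_1I)
    fix e e' assume "e \<in> ?I" "e' \<in> ?I"
    then obtain a w a' w' where e: "e = (w, a, v)" "e' = (w', a', v)" "(w, a, v) \<in> E" "(w', a', v) \<in> E"
      by (cases e; cases e') auto
    then have "a = a'" using I[OF e(3)] I[OF e(4)] by simp
    then show "e = e'" using codet e by blast
  qed
  have "?O = {} \<or> ?I = {}"
  proof (rule ccontr)
    assume "\<not> (?O = {} \<or> ?I = {})"
    then obtain a w a' w' where "(v, a, w) \<in> E" "(w', a', v) \<in> E" by fastforce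
    then show False using O[of a w] I[of w' a'] by simp
  qed
  then have "card ?O = 0 \<or> card ?I = 0" by (rule disj_forward) (simp_all only: card.empty)
  then show False using nl cO cI unfolding leaf_def by linarith
qed

text \<open>
  Let \<open>R\<close> be the set of directed edges reachable from \<open>d\<close>, and suppose
  that no edge of \<open>R\<close> ends in \<open>p\<close>. If an edge \<open>e\<close> that is
  reachable from \<open>d0\<close> could be traversed in the opposite direction within
  \<open>R\<close>, then reversing the path from \<open>d0\<close> to \<open>e\<close> would lead
  back to \<open>p\<close>. Two different edges with the same head, one of them in
  \<open>R\<close>, would permit exactly that. So edges of \<open>R\<close> have different heads,
  and choosing a successor of each (there is no leaf to stop at) gives an injection, hence a
  bijection, of the finite set \<open>R\<close> to itself. Then \<open>R\<close> is also closed
  under going backwards along the path from \<open>d0\<close> to \<open>d\<close>, so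
  \<open>d0\<close> has a predecessor in \<open>R\<close>; but that edge ends in \<open>p\<close>.
\<close>

lemma nonbacktracking_return:
  assumes adm: "admissible A V E p" and d0: "reads E (fst d0) [fst (snd d0)] (snd (snd d0))" "fst d0 = p"
    and d: "(d0, d) \<in> (nonbacktracking E)\<^sup>*"
  shows "\<exists>e. (d, e) \<in> (nonbacktracking E)\<^sup>* \<and> snd (snd e) = p"
proof (rule ccontr)
  assume no: "\<nexists>e. (d, e) \<in> (nonbacktracking E)\<^sup>* \<and> snd (snd e) = p"
  have G: "A_graph A V E" and p: "p \<in> V" and E: "finite E" and nl: "\<And>v. v \<in> V \<Longrightarrow> v \<noteq> p \<Longrightarrow> \<not> leaf E v"
    using adm by (auto simp: admissible_def)
  define R where "R = {e. (d, e) \<in> (nonbacktracking E)\<^sup>*}"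
  have R0: "(d0, e) \<in> (nonbacktracking E)\<^sup>*" if "e \<in> R" for e using that d by (auto simp: R_def)
  have edge: "reads E (fst e) [fst (snd e)] (snd (snd e))" if "(d0, e) \<in> (nonbacktracking E)\<^sup>*" for e
    using that d0(1) by (cases rule: rtranclE) (auto simp: nonbacktracking_def)
  have headV: "snd (snd e) \<in> V" if "(d0, e) \<in> (nonbacktracking E)\<^sup>*" for e
    using edge[OF that] G unfolding A_graph_def by (cases "fst (snd e)") (auto split: if_splits)
  have no_flip: "flip e \<notin> R" if "(d0, e) \<in> (nonbacktracking E)\<^sup>*" for e
  proof
    assume "flip e \<in> R"
    then have "(d, flip d0) \<in> (nonbacktracking E)\<^sup>*" using nonbacktracking_rtrancl_flip[OF that] by (auto simp: R_def)
    moreover have "snd (snd (flip d0)) = p" using d0(2) by (cases d0) auto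
    ultimately show False using no by blast
  qed
  have same_head: "e = e'" if "e \<in> R" "(d0, e') \<in> (nonbacktracking E)\<^sup>*" "snd (snd e) = snd (snd e')" for e e'
  proof (rule ccontr)
    assume ne: "e \<noteq> e'"
    note same = that(3)
    obtain u x v u' x' where e: "e = (u, x, v)" "e' = (u', x', v)" using same by (cases e; cases e') auto
    have r: "reads E u [x] v" "reads E u' [x'] v" using edge[OF R0[OF that(1)]] edge[OF that(2)] by (auto simp only: e fst_conv snd_conv)
    have "x \<noteq> x'"
    proof
      assume "x = x'"
      then have "u = u'" using r reads_unique[OF G, of v "[letter_inv x]" u u'] by (simp only: reads_letter_inv)
      then show False using ne e \<open>x = x'\<close> by simp
    qed
    then have "(e, flip e') \<in> nonbacktracking E"
      unfolding nonbacktracking_def e flip.simps mem_Collect_eq case_prod_conv reads_letter_inv using r by simp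
    then have "flip e' \<in> R" using that(1) by (auto simp: R_def intro: rtrancl_into_rtrancl)
    then show False using no_flip[OF that(2)] by simp
  qed
  have "\<exists>f. (e, f) \<in> nonbacktracking E" if "e \<in> R" for e
  proof -
    obtain u x v where e: "e = (u, x, v)" by (cases e)
    have "v \<noteq> p" using no that by (metis R_def e mem_Collect_eq snd_conv)
    moreover have "v \<in> V" using headV[OF R0[OF that]] by (simp add: e)
    ultimately show ?thesis
      using nonbacktracking_step[OF G nl, of v u x] edge[OF R0[OF that]] unfolding e fst_conv snd_conv by blast
  qed
  then have "\<forall>e\<in>R. \<exists>f. (e, f) \<in> nonbacktracking E" by blast
  from bchoice[OF this] obtain s where s: "(e, s e) \<in> nonbacktracking E" if "e \<in> R" for e by blast
  have head: "snd (snd e) = fst (s e)" if "e \<in> R" for e using s[OF that] by (auto simp: nonbacktracking_def)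
  have inj: "inj_on s R"
    by (rule inj_onI) (metis head same_head R0)
  have "s ` R \<subseteq> R" using s by (auto simp: R_def intro: rtrancl_into_rtrancl)
  moreover have "finite R"
  proof (rule finite_subset[OF _ finite_directed_edges[OF E]])
    show "R \<subseteq> {(u, x, v). reads E u [x] v}" using edge R0 by fastforce
  qed
  ultimately have surj: "s ` R = R" using inj by (simp add: endo_inj_surj)
  have closed_back: "c \<in> R" if "(c, d) \<in> (nonbacktracking E)\<^sup>*" "(d0, c) \<in> (nonbacktracking E)\<^sup>*" for c
    using that
  proof (induction rule: converse_rtrancl_induct)
    case base
    show ?case by (simp add: R_def)
  next
    case (step c c')
    have "c' \<in> R" using step by (meson rtrancl.rtrancl_into_rtrancl)
    then obtain e where e: "e \<in> R" "c' = s e" using surj by blast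
    have "snd (snd c) = fst c'" using step(1) by (auto simp: nonbacktracking_def)
    then have "e = c" using e step.prems by (intro same_head) (auto simp: head)
    then show ?case using e by simp
  qed
  have "d0 \<in> R" using closed_back[OF d] by simp
  then obtain e where e: "e \<in> R" "d0 = s e" using surj by blast
  then have "snd (snd e) = p" using head d0(2) by simp
  moreover have "(d, e) \<in> (nonbacktracking E)\<^sup>*" using e(1) by (simp add: R_def)
  ultimately show False using no by blast
qed

section \<open>Uniqueness of the Stallings graph\<close>

lemma reduced_append_single:
  "reduced (w @ [x] @ z) \<longleftrightarrow> reduced (w @ [x]) \<and> reduced ([x] @ z)"
  by (cases z) (auto simp: reduced_def successively_append_iff)

lemma reduced_prefix: "reduced (w @ z) \<Longrightarrow> reduced w"
  by (simp add: reduced_def successively_append_iff)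

lemma nonbacktracking_path_of_reduced:
  assumes "reduced (w @ [x])" "reads E p w u" "reads E u [x] v"
  shows "\<exists>d0. fst d0 = p \<and> reads E (fst d0) [fst (snd d0)] (snd (snd d0)) \<and> (d0, (u, x, v)) \<in> (nonbacktracking E)\<^sup>*"
  using assms
proof (induction w arbitrary: x u v rule: rev_induct)
  case Nil
  then show ?case by (intro exI[of _ "(u, x, v)"]) simp
next
  case (snoc y w)
  obtain t where t: "reads E p w t" "reads E t [y] u"
    using snoc.prems(2) by (auto simp only: reads_append)
  have "reduced (w @ [y])" using snoc.prems(1) by (rule reduced_prefix)
  from snoc.IH[OF this t] obtain d0 where
    d0: "fst d0 = p" "reads E (fst d0) [fst (snd d0)] (snd (snd d0))" "(d0, (t, y, u)) \<in> (nonbacktracking E)\<^sup>*" by blast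
  have "x \<noteq> letter_inv y"
    using snoc.prems(1) by (simp add: reduced_def successively_append_iff)
  then have "((t, y, u), (u, x, v)) \<in> nonbacktracking E"
    using t(2) snoc.prems(3) by (simp only: nonbacktracking_def mem_Collect_eq case_prod_conv simp_thms)
  then have "(d0, (u, x, v)) \<in> (nonbacktracking E)\<^sup>*" using d0(3) by (rule rtrancl_into_rtrancl[rotated])
  then show ?case using d0(1,2) by (intro exI[of _ d0] conjI)
qed

lemma reduced_of_nonbacktracking_path:
  assumes "((u, x, v), e) \<in> (nonbacktracking E)\<^sup>*"
  shows "\<exists>z. reads E v z (snd (snd e)) \<and> reduced (x # z)"
  using assms
proof (induction "(u, x, v)" arbitrary: u x v rule: converse_rtrancl_induct)
  case base
  have "v = snd (snd e)" using base by (metis snd_conv)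
  then show ?case by (intro exI[of _ "[]"]) (simp add: reduced_def)
next
  case (step d')
  obtain y w where d': "d' = (v, y, w)" "y \<noteq> letter_inv x" "reads E v [y] w"
    using step(1) by (cases d') (auto simp: nonbacktracking_def)
  obtain z where z: "reads E w z (snd (snd e))" "reduced (y # z)" using step(3)[OF d'(1)] by blast
  have "reads E v (y # z) (snd (snd e))" using z d'(3) reads_Cons[of E v y z] by blast
  moreover have "reduced (x # y # z)" using z(2) d'(2) by (simp add: reduced_def)
  ultimately show ?case by blast
qed

text \<open>
  This is where the absence of leaves away from the base point enters: it makes the graph
  recoverable from the reduced words that label loops.
\<close>

lemma reduced_word_returns:
  assumes adm: "admissible A V E p" and w: "reduced w" "reads E p w v"
  shows "\<exists>z. reduced (w @ z) \<and> reads E p (w @ z) p"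
proof (cases w rule: rev_cases)
  case Nil
  then show ?thesis by (intro exI[of _ "[]"]) simp
next
  case (snoc w' x)
  obtain u where u: "reads E p w' u" "reads E u [x] v"
    using w(2) unfolding snoc reads_append by blast
  obtain d0 where d0: "fst d0 = p" "reads E (fst d0) [fst (snd d0)] (snd (snd d0))"
      "(d0, (u, x, v)) \<in> (nonbacktracking E)\<^sup>*"
    using nonbacktracking_path_of_reduced[OF w(1)[unfolded snoc] u] by blast
  obtain e where e: "((u, x, v), e) \<in> (nonbacktracking E)\<^sup>*" "snd (snd e) = p"
    using nonbacktracking_return[OF adm d0(2,1,3)] by blast
  obtain z where z: "reads E v z p" "reduced (x # z)"
    using reduced_of_nonbacktracking_path[OF e(1)] e(2) by blast
  have "reduced (w @ z)"
    using reduced_append_single[of w' x z] w(1) z(2) by (simp add: snoc)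
  moreover have "reads E p (w @ z) p" using w(2) z(1) reads_append by metis
  ultimately show ?thesis by blast
qed

text \<open>
  Reduced words are transferred by extending them to loops. For an arbitrary word, pass to the
  reduction of its part before the last letter; if the last letter cancels there, then it can be
  read by going one edge back.
\<close>

lemma readable_transfer:
  assumes adm: "admissible A V E p" and adm': "admissible A V' E' p'"
    and H: "loop_group A E p = loop_group A E' p'"
  shows "reads E p w v \<Longrightarrow> \<exists>v'. reads E' p' w v'"
proof (induction w arbitrary: v rule: rev_induct)
  case Nil
  show ?case by (rule exI[of _ p']) simp
next
  case (snoc x w)
  have G: "A_graph A V E" and G': "A_graph A V' E'" using adm adm' by (auto simp: admissible_def)
  have red: "\<exists>v'. reads E' p' y v'" if y: "reduced y" "reads E p y v" for y v
  proof -
    obtain z where z: "reduced (y @ z)" "reads E p (y @ z) p"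
      using reduced_word_returns[OF adm y] by blast
    then have "y @ z \<in> loop_group A E p"
      using reads_letters[OF G z(2)] by (simp add: loop_group_def carrier_free_group)
    then have "reads E' p' (y @ z) p'" unfolding H by (simp add: loop_group_def)
    then show ?thesis unfolding reads_append by blast
  qed
  obtain u where u: "reads E p w u" "reads E u [x] v" using snoc.prems unfolding reads_append by blast
  obtain u' where u': "reads E' p' w u'" using snoc.IH[OF u(1)] by blast
  let ?w = "reduce w"
  have ru: "reads E p ?w u" "reads E' p' ?w u'"
    using reads_reduce[OF G u(1)] reads_reduce[OF G' u'] by blast+
  have "\<exists>v'. reads E' u' [x] v'"
  proof (cases "reduced (?w @ [x])")
    case True
    have "reads E p (?w @ [x]) v" unfolding reads_append using ru u by blast
    from red[OF True this] obtain v' y' where "reads E' p' ?w y'" "reads E' y' [x] v'"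
      unfolding reads_append by blast
    then show ?thesis using reads_unique[OF G' ru(2)] by blast
  next
    case False
    then have "?w \<noteq> []" by (auto simp: reduced_def)
    then obtain w0 y where w0: "?w = w0 @ [y]" by (cases ?w rule: rev_cases) auto
    have "reduced (w0 @ [y])" using reduced_reduce[of w] unfolding w0 .
    then have "x = letter_inv y"
      using False unfolding w0 by (simp add: reduced_def successively_append_iff)
    obtain t where "reads E' p' w0 t" "reads E' t [y] u'" using ru(2) unfolding w0 reads_append by blast
    then have "reads E' u' [x] t" unfolding \<open>x = letter_inv y\<close> reads_letter_inv by blast
    then show ?thesis by blast
  qed
  then show ?case unfolding reads_append using u' by blast
qed

text \<open>
  Two words end in the same vertex if and only if their quotient belongs to the subgroup.
\<close>

lemma endpoint_transfer:
  assumes G: "A_graph A V E" and G': "A_graph A V' E'"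
    and H: "loop_group A E p = loop_group A E' p'"
    and r: "reads E p w1 v" "reads E p w2 v" and r': "reads E' p' w1 v1" "reads E' p' w2 v2"
  shows "v1 = v2"
proof -
  let ?h = "reduce (w1 @ winv w2)"
  have "reads E p (w1 @ winv w2) p" unfolding reads_append reads_winv using r by blast
  then have "?h \<in> loop_group A E p" by (rule reduce_in_loop_group[OF G])
  then have "reads E' p' ?h p'" unfolding H by (simp add: loop_group_def)
  then have "reads E' v1 (winv w1 @ ?h @ w2) v2" unfolding reads_append reads_winv using r' by blast
  then have "reads E' v1 (reduce (winv w1 @ ?h @ w2)) v2" by (rule reads_reduce[OF G'])
  moreover have "reduce (winv w1 @ ?h @ w2) = reduce (winv w1 @ w1 @ winv w2 @ w2)"
    by (metis append.assoc reduce_append_reduce)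
  moreover have "\<dots> = []"
    using reduce_winv_cancel[of "[]" w1 "winv w2 @ w2"] reduce_inverse[of w2] by simp
  ultimately show ?thesis by simp
qed

definition relabel :: "('v \<Rightarrow> 'w) \<Rightarrow> ('v \<times> 'a \<times> 'v) set \<Rightarrow> ('w \<times> 'a \<times> 'w) set" where
  "relabel h E = (\<lambda>(u, a, v). (h u, a, h v)) ` E"

text \<open>
  The isomorphism sends the endpoint of a word in one graph to its endpoint in the other.
\<close>

lemma stallings_graph_unique:
  assumes adm: "admissible A V E p" and adm': "admissible A V' E' p'"
    and H: "loop_group A E p = loop_group A E' p'"
  shows "\<exists>h. bij_betw h V V' \<and> h p = p' \<and> E' = relabel h E"
proof -
  have G: "A_graph A V E" and G': "A_graph A V' E'" and p: "p \<in> V" "p' \<in> V'"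
    and c: "connected_graph V E" "connected_graph V' E'"
    using adm adm' by (auto simp: admissible_def)
  define h where "h v = (SOME v'. \<exists>w. reads E p w v \<and> reads E' p' w v')" for v
  have h: "h v = v'" if "reads E p w v" "reads E' p' w v'" for v v' w
    unfolding h_def
  proof (rule some_equality)
    show "\<exists>w. reads E p w v \<and> reads E' p' w v'" using that by blast
    show "y = v'" if "\<exists>w. reads E p w v \<and> reads E' p' w y" for y
    proof -
      from that obtain w' where w': "reads E p w' v" "reads E' p' w' y" by blast
      show ?thesis
        by (rule endpoint_transfer[OF G G' H w'(1) \<open>reads E p w v\<close> w'(2) \<open>reads E' p' w v'\<close>])
    qed
  qed
  have ex: "\<exists>w v'. reads E p w v \<and> reads E' p' w v'" if "v \<in> V" for v
    using connected_reads[OF c(1) p(1) that] readable_transfer[OF adm adm' H] by blast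
  have ex': "\<exists>w v. reads E p w v \<and> reads E' p' w v'" if "v' \<in> V'" for v'
    using connected_reads[OF c(2) p(2) that] readable_transfer[OF adm' adm H[symmetric]] by blast
  have hread: "reads E' p' w (h v)" if r: "reads E p w v" for w v
  proof -
    obtain v' where "reads E' p' w v'" using readable_transfer[OF adm adm' H r] by blast
    then show ?thesis using h[OF r] by simp
  qed
  have inj: "inj_on h V"
  proof (rule inj_onI)
    fix u v assume uv: "u \<in> V" "v \<in> V" "h u = h v"
    obtain w1 w2 where w: "reads E p w1 u" "reads E p w2 v" using ex uv by blast
    show "u = v"
      by (rule endpoint_transfer[OF G' G H[symmetric] hread[OF w(1)] _ w])
        (use hread[OF w(2)] uv(3) in simp)
  qed
  have "h ` V = V'"
  proof (intro equalityI subsetI)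
    fix y assume "y \<in> h ` V"
    then obtain v where v: "v \<in> V" "y = h v" by blast
    obtain w where "reads E p w v" using ex v(1) by blast
    then show "y \<in> V'" using reads_in_V[OF G' hread p(2)] v(2) by blast
  next
    fix v' assume "v' \<in> V'"
    then obtain w v where wv: "reads E p w v" "reads E' p' w v'" using ex' by blast
    then have "h v = v'" by (rule h)
    moreover have "v \<in> V" using reads_in_V[OF G wv(1) p(1)] .
    ultimately show "v' \<in> h ` V" by blast
  qed
  moreover have "h p = p'" by (rule h[of "[]"]) simp_all
  moreover have "E' = relabel h E"
  proof (intro equalityI subsetI)
    fix e assume "e \<in> relabel h E"
    then obtain u a v where e: "e = (h u, a, h v)" "(u, a, v) \<in> E" by (auto simp: relabel_def)
    have "u \<in> V" using e(2) G by (auto simp: A_graph_def)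
    then obtain w where w: "reads E p w u" using ex by blast
    have "reads E p (w @ [(a, True)]) v" unfolding reads_append using w e(2) by auto
    then have "reads E' p' (w @ [(a, True)]) (h v)" by (rule hread)
    then obtain y where y: "reads E' p' w y" "(y, a, h v) \<in> E'" unfolding reads_append by auto
    then show "e \<in> E'" using h[OF w y(1)] by (simp add: e)
  next
    fix e assume "e \<in> E'"
    then obtain u' a v' where e: "e = (u', a, v')" "(u', a, v') \<in> E'" by (cases e) auto
    have "u' \<in> V'" using e(2) G' by (auto simp: A_graph_def)
    then obtain w u where w: "reads E p w u" "reads E' p' w u'" using ex' by blast
    have r': "reads E' p' (w @ [(a, True)]) v'" unfolding reads_append using w e(2) by auto
    then obtain v where r: "reads E p (w @ [(a, True)]) v"
      using readable_transfer[OF adm' adm H[symmetric]] by blast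
    then obtain y where y: "reads E p w y" "(y, a, v) \<in> E" unfolding reads_append by auto
    have "y = u" using reads_unique[OF G y(1) w(1)] .
    then have "(h u, a, h v) \<in> relabel h E" using y(2) by (force simp: relabel_def)
    then show "e \<in> relabel h E" using h[OF w] h[OF r r'] by (simp add: e)
  qed
  ultimately show ?thesis using inj unfolding bij_betw_def by blast
qed

lemma reads_relabel: "reads E u w v \<Longrightarrow> reads (relabel h E) (h u) w (h v)"
proof (induction w arbitrary: u)
  case (Cons x w)
  obtain y where y: "reads E u [x] y" "reads E y w v" using Cons.prems reads_Cons[of E u x w v] by blast
  have "reads (relabel h E) (h u) [x] (h y)"
    using y(1) by (cases x) (force simp: relabel_def split: if_splits)
  then show ?case using Cons.IH[OF y(2)] reads_Cons[of "relabel h E" "h u" x w] by blast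
qed simp

lemma relabel_relabel: "relabel g (relabel h E) = relabel (g \<circ> h) E"
  by (auto simp: relabel_def image_image case_prod_beta)

lemma relabel_cong:
  assumes "E \<subseteq> V \<times> A \<times> V" "\<And>v. v \<in> V \<Longrightarrow> g v = h v"
  shows "relabel g E = relabel h E"
  unfolding relabel_def using assms by (intro image_cong) auto

lemma relabel_id: "relabel id E = E"
  by (force simp: relabel_def)

lemma relabel_inv:
  assumes "E \<subseteq> V \<times> A \<times> V" "inj_on h V"
  shows "relabel (inv_into V h) (relabel h E) = E"
proof -
  have "relabel (inv_into V h) (relabel h E) = relabel id E"
    unfolding relabel_relabel by (rule relabel_cong[OF assms(1)]) (simp add: assms(2))
  then show ?thesis by (simp only: relabel_id)
qed

lemma reads_relabel_iff:
  assumes "E \<subseteq> V \<times> A \<times> V" "inj_on h V" "u \<in> V" "v \<in> V"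
  shows "reads (relabel h E) (h u) w (h v) \<longleftrightarrow> reads E u w v"
proof
  assume "reads (relabel h E) (h u) w (h v)"
  from reads_relabel[OF this, of "inv_into V h"] show "reads E u w v"
    using assms by (simp add: relabel_inv)
qed (rule reads_relabel)

lemma loop_group_relabel:
  assumes "E \<subseteq> V \<times> A \<times> V" "inj_on h V" "p \<in> V"
  shows "loop_group A (relabel h E) (h p) = loop_group A E p"
  using reads_relabel_iff[OF assms(1,2,3,3)] by (simp add: loop_group_def)

lemma admissible_relabel:
  assumes adm: "admissible A V E p" and inj: "inj_on h V"
  shows "admissible A (h ` V) (relabel h E) (h p)"
proof -
  have EV: "E \<subseteq> V \<times> A \<times> V" using adm by (auto simp: admissible_def A_graph_def)
  have G: "A_graph A V E" and conn: "connected_graph V E" using adm by (auto simp: admissible_def)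
  have mem: "(h u, a, h v) \<in> relabel h E \<longleftrightarrow> (u, a, v) \<in> E" if "u \<in> V" "v \<in> V" for u a v
    using reads_relabel_iff[OF EV inj that, of "[(a, True)]"] by simp
  have sub: "relabel h E \<subseteq> h ` V \<times> A \<times> h ` V" using EV by (auto simp: relabel_def)
  have "A_graph A (h ` V) (relabel h E)"
    unfolding A_graph_def
  proof (intro conjI allI impI sub)
    fix u a v v' assume e: "(u, a, v) \<in> relabel h E" "(u, a, v') \<in> relabel h E"
    then obtain u0 v0 v1 where "u = h u0" "v = h v0" "v' = h v1" "u0 \<in> V" "v0 \<in> V" "v1 \<in> V"
      using sub by blast
    then show "v = v'" using e G unfolding A_graph_def by (metis mem)
  next
    fix u u' a v assume e: "(u, a, v) \<in> relabel h E" "(u', a, v) \<in> relabel h E"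
    then obtain u0 u1 v0 where "u = h u0" "u' = h u1" "v = h v0" "u0 \<in> V" "v0 \<in> V" "u1 \<in> V"
      using sub by blast
    then show "u = u'" using e G unfolding A_graph_def by (metis mem)
  qed
  moreover have "connected_graph (h ` V) (relabel h E)"
    unfolding connected_graph_def
  proof (intro ballI)
    fix x y assume "x \<in> h ` V" "y \<in> h ` V"
    then obtain u v where uv: "u \<in> V" "v \<in> V" "x = h u" "y = h v" by blast
    have "(u, v) \<in> {(x, y). \<exists>a. (x, a, y) \<in> E \<or> (y, a, x) \<in> E}\<^sup>*"
      using conn uv by (simp add: connected_graph_def)
    then have "(h u, h v) \<in> {(x, y). \<exists>a. (x, a, y) \<in> relabel h E \<or> (y, a, x) \<in> relabel h E}\<^sup>*"
    proof (induction rule: rtrancl_induct)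
      case (step y z)
      then obtain a where "(y, a, z) \<in> E \<or> (z, a, y) \<in> E" by blast
      then have "(h y, a, h z) \<in> relabel h E \<or> (h z, a, h y) \<in> relabel h E"
        by (force simp: relabel_def)
      then show ?case by (intro rtrancl_into_rtrancl[OF step(3)]) blast
    qed simp
    then show "(x, y) \<in> {(x, y). \<exists>a. (x, a, y) \<in> relabel h E \<or> (y, a, x) \<in> relabel h E}\<^sup>*"
      by (simp only: uv)
  qed
  moreover have "\<not> leaf (relabel h E) x" if x: "x \<in> h ` V" "x \<noteq> h p" for x
  proof -
    obtain v where v: "v \<in> V" "x = h v" using x by blast
    let ?k = "\<lambda>(u, a, w). (h u, a, h w)"
    have injk: "inj_on ?k E"
      using EV inj by (auto simp: inj_on_def)
    have hx: "h u = x \<longleftrightarrow> u = v" if "u \<in> V" for u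
      using inj v that by (auto simp: inj_on_def)
    have fs: "fst (?k e) = x \<longleftrightarrow> fst e = v" "snd (snd (?k e)) = x \<longleftrightarrow> snd (snd e) = v" if "e \<in> E" for e
    proof -
      have eE: "e \<in> V \<times> A \<times> V" using that EV by blast
      obtain u a w where "e = (u, a, w)" "u \<in> V" "w \<in> V" using eE by blast
      then show "fst (?k e) = x \<longleftrightarrow> fst e = v" "snd (snd (?k e)) = x \<longleftrightarrow> snd (snd e) = v"
        by (simp_all add: hx)
    qed
    have 1: "{e \<in> relabel h E. fst e = x} = ?k ` {e \<in> E. fst e = v}"
      unfolding relabel_def using fs(1) by blast
    have 2: "{e \<in> relabel h E. snd (snd e) = x} = ?k ` {e \<in> E. snd (snd e) = v}"
      unfolding relabel_def using fs(2) by blast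
    have "card {e \<in> relabel h E. fst e = x} = card {e \<in> E. fst e = v}"
      unfolding 1 by (rule card_image[OF inj_on_subset[OF injk]]) blast
    moreover have "card {e \<in> relabel h E. snd (snd e) = x} = card {e \<in> E. snd (snd e) = v}"
      unfolding 2 by (rule card_image[OF inj_on_subset[OF injk]]) blast
    moreover have "\<not> leaf E v" using adm v x by (auto simp: admissible_def)
    ultimately show ?thesis by (simp add: leaf_def)
  qed
  ultimately show ?thesis using adm by (auto simp: admissible_def relabel_def)
qed

text \<open>
  A vertex is the endpoint of a word read from the base point, so its image is determined by the
  relabelled graph and the image of the base point.
\<close>

lemma relabel_rigid:
  assumes adm: "admissible A V E p" and eq: "relabel g E = relabel h E" "g p = h p"
    and inj: "inj_on g V" and v: "v \<in> V"
  shows "g v = h v"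
proof -
  obtain w where w: "reads E p w v" using adm v connected_reads by (fastforce simp: admissible_def)
  have "reads (relabel g E) (g p) w (g v)" "reads (relabel g E) (g p) w (h v)"
    using reads_relabel[OF w, of g] reads_relabel[OF w, of h] eq by auto
  moreover have "A_graph A (g ` V) (relabel g E)"
    using admissible_relabel[OF adm inj] by (simp add: admissible_def)
  ultimately show ?thesis using reads_unique by metis
qed

section \<open>Malnormality restricts the cycles of each letter\<close>

lemma reduced_replicate: "reduced (replicate k (a, True))"
proof (induction k)
  case (Suc k)
  then show ?case by (cases k) (auto simp: reduced_def)
qed simp

text \<open>
  With words \<open>t\<close>, \<open>t'\<close> from the base point to \<open>v\<close>,
  \<open>v'\<close>, and \<open>c\<close> the power of the letter, both \<open>h = t c
  t\<^sup>-\<^sup>1\<close> and \<open>h' = t' c t'\<^sup>-\<^sup>1\<close> belong to the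
  subgroup, and \<open>g = t' t\<^sup>-\<^sup>1\<close> conjugates \<open>h'\<close> to
  \<open>h\<close>. But \<open>h \<noteq> 1\<close>, and \<open>g\<close> is in the subgroup only
  if \<open>v = v'\<close>.
\<close>

lemma malnormal_power_loop_unique:
  assumes adm: "admissible A V E p" and mal: "malnormal (free_group A) (loop_group A E p)"
    and v: "v \<in> V" "v' \<in> V" and k: "k > 0"
    and r: "reads E v (replicate k (a, True)) v" "reads E v' (replicate k (a, True)) v'"
  shows "v = v'"
proof (rule ccontr)
  assume ne: "v \<noteq> v'"
  have G: "A_graph A V E" and p: "p \<in> V" and conn: "connected_graph V E"
    using adm by (auto simp: admissible_def)
  let ?G = "free_group A" and ?H = "loop_group A E p"
  obtain t t' where t: "reads E p t v" "reads E p t' v'" using connected_reads[OF conn p] v by blast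
  define c where "c = replicate k (a, True)"
  define h h' g where "h = reduce (t @ c @ winv t)" and "h' = reduce (t' @ c @ winv t')"
    and "g = reduce (t' @ winv t)"
  have "reads E p (t @ c @ winv t) p" "reads E p (t' @ c @ winv t') p"
    unfolding reads_append reads_winv using t r by (auto simp only: c_def)
  then have hH: "h \<in> ?H" "h' \<in> ?H"
    unfolding h_def h'_def using reduce_in_loop_group[OF G] by blast+
  have let_t: "set t \<subseteq> A \<times> UNIV" "set t' \<subseteq> A \<times> UNIV" using reads_letters[OF G] t by blast+
  have gG: "g \<in> carrier ?G" "reduce (t @ winv t') \<in> carrier ?G"
    unfolding g_def by (rule reduce_in_carrier, use let_t set_winv in auto)+
  have "g \<notin> ?H"
  proof
    assume "g \<in> ?H"
    then have "reads E p g p" by (simp add: loop_group_def)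
    then have "reads E v' (winv t' @ g @ t) v" unfolding reads_append reads_winv using t by blast
    then have "reads E v' (reduce (winv t' @ g @ t)) v" by (rule reads_reduce[OF G])
    moreover have "reduce (winv t' @ g @ t) = reduce (winv t' @ t' @ winv t @ t)"
      unfolding g_def by (metis append.assoc reduce_append_reduce)
    moreover have "\<dots> = []"
      using reduce_winv_cancel[of "[]" t' "winv t @ t"] reduce_inverse[of t] by simp
    ultimately show False using ne by simp
  qed
  have inv: "inv\<^bsub>?G\<^esub> g = reduce (t @ winv t')"
  proof (rule group.inv_equality[OF group_free_group _ gG])
    have "reduce (reduce (t @ winv t') @ g) = reduce (t @ winv t' @ t' @ winv t)"
      unfolding g_def by (simp add: reduce_append_reduce)
    also have "\<dots> = []"
      using reduce_winv_cancel[of t t' "winv t"] reduce_inverse[of "winv t"] by (simp del: winv_winv) (simp only: winv_winv)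
    finally show "reduce (t @ winv t') \<otimes>\<^bsub>?G\<^esub> g = \<one>\<^bsub>?G\<^esub>" by simp
  qed
  have "inv\<^bsub>?G\<^esub> g \<otimes>\<^bsub>?G\<^esub> h' \<otimes>\<^bsub>?G\<^esub> g = reduce (((t @ winv t') @ (t' @ c @ winv t')) @ (t' @ winv t))"
    unfolding inv mult_free_group unfolding g_def h'_def by (simp only: reduce_append_reduce)
  also have "\<dots> = h"
    using reduce_winv_cancel[of t t' "c @ winv t' @ t' @ winv t"]
      reduce_winv_cancel[of "t @ c" t' "winv t"] by (simp add: h_def)
  finally have "h \<in> ?H \<inter> (\<lambda>h. inv\<^bsub>?G\<^esub> g \<otimes>\<^bsub>?G\<^esub> h \<otimes>\<^bsub>?G\<^esub> g) ` ?H" using hH by (metis IntI imageI)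
  then have "h \<in> {\<one>\<^bsub>?G\<^esub>}" using mal gG(1) \<open>g \<notin> ?H\<close> unfolding malnormal_def by blast
  then have "h = []" by simp
  then have "reduce (winv t @ h @ t) = []" using reduce_inverse[of t] by simp
  moreover have "reduce (winv t @ h @ t) = reduce (winv t @ (t @ c @ winv t) @ t)"
    unfolding h_def by (metis append.assoc reduce_append_reduce)
  moreover have "\<dots> = c"
    using reduce_winv_cancel[of "[]" t "c @ winv t @ t"] reduce_winv_cancel[of c t "[]"]
      reduce_reduced[OF reduced_replicate[of k a]] by (simp add: c_def)
  ultimately show False using k by (simp add: c_def)
qed

definition letter_rel :: "('v \<times> 'a \<times> 'v) set \<Rightarrow> 'a \<Rightarrow> 'v rel" where
  "letter_rel E a = {(u, v). (u, a, v) \<in> E}"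

lemma letter_rel_partial_inj: "A_graph A V E \<Longrightarrow> letter_rel E a \<in> partial_inj V"
  unfolding A_graph_def letter_rel_def partial_inj_def single_valued_def by blast

lemma reads_of_relpow: "(u, v) \<in> letter_rel E a ^^ k \<Longrightarrow> reads E u (replicate k (a, True)) v"
proof (induction k arbitrary: u)
  case (Suc k)
  then obtain y where "(u, y) \<in> letter_rel E a" "(y, v) \<in> letter_rel E a ^^ k"
    by (meson relpow_Suc_D2)
  then show ?case using Suc.IH by (auto simp: letter_rel_def)
qed simp

lemma relpow_loop: "(v, v) \<in> R ^^ k \<Longrightarrow> (v, v) \<in> R ^^ (k * m)"
  by (induction m) (auto simp: relpow_add)

text \<open>
  At any two vertices on cycles of the letter, a common power of it labels loops, its exponent
  being the product of the two cycle lengths. So there is at most one such vertex.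
\<close>

lemma letter_rel_loop_only:
  assumes adm: "admissible A V E p" and mal: "malnormal (free_group A) (loop_group A E p)"
  shows "letter_rel E a \<in> loop_only_inj V"
proof -
  define R where "R = letter_rel E a"
  have G: "A_graph A V E" using adm by (auto simp: admissible_def)
  have R: "R \<in> partial_inj V" unfolding R_def by (rule letter_rel_partial_inj[OF G])
  have RV: "R \<subseteq> V \<times> V" using R by (simp add: partial_inj_def)
  have cyc: "v = w" if vw: "(v, v) \<in> R\<^sup>+" "(w, w) \<in> R\<^sup>+" for v w
  proof -
    have VV: "v \<in> V" "w \<in> V" using trancl_subset_Sigma[OF RV] vw by blast+
    obtain k m where km: "k > 0" "(v, v) \<in> R ^^ k" "m > 0" "(w, w) \<in> R ^^ m"
      using vw by (auto simp: trancl_power)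
    have "(v, v) \<in> R ^^ (k * m)" by (rule relpow_loop[OF km(2)])
    moreover have "(w, w) \<in> R ^^ (k * m)"
      using relpow_loop[OF km(4), of k] by (simp only: mult.commute)
    ultimately show ?thesis
      using malnormal_power_loop_unique[OF adm mal VV, of "k * m" a] km(1,3)
      by (simp add: R_def reads_of_relpow)
  qed
  show ?thesis
  proof (cases "acyclic R")
    case True
    then show ?thesis using R by (simp add: loop_only_inj_def acyclic_inj_def R_def)
  next
    case False
    then obtain v where v: "(v, v) \<in> R\<^sup>+" by (auto simp: acyclic_def)
    then obtain w where w: "(v, w) \<in> R" "(w, v) \<in> R\<^sup>*" by (meson tranclD)
    then have "(w, w) \<in> R\<^sup>+" by (meson rtrancl_into_trancl1)
    then have "w = v" using cyc v by blast
    then have vv: "(v, v) \<in> R" using w by simp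
    define f where "f = R - {(v, v)}"
    have fV: "f \<subseteq> (V - {v}) \<times> (V - {v})"
    proof
      fix e assume "e \<in> f"
      then obtain x y where e: "e = (x, y)" "(x, y) \<in> R" "\<not> (x = v \<and> y = v)" by (cases e) (auto simp: f_def)
      have sv: "single_valued R" "single_valued (R\<inverse>)" using R by (auto simp: partial_inj_def)
      have "x \<noteq> v" using single_valuedD[OF sv(1) vv, of y] e by blast
      moreover have "y \<noteq> v" using single_valuedD[OF sv(2), of v v x] vv e by blast
      ultimately show "e \<in> (V - {v}) \<times> (V - {v})" using e RV by blast
    qed
    have "f \<in> partial_inj V" using R by (rule partial_inj_subset) (simp add: f_def)
    moreover have "acyclic f"
    proof (rule acyclicI, intro allI notI)
      fix x assume x: "(x, x) \<in> f\<^sup>+"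
      have "(x, x) \<in> R\<^sup>+" using trancl_mono[OF x, of R] by (auto simp: f_def)
      then have "x = v" using cyc v by blast
      moreover have "x \<in> V - {v}" using trancl_subset_Sigma[OF fV] x by blast
      ultimately show False by simp
    qed
    ultimately have "f \<in> acyclic_inj (V - {v})" using fV by (simp add: acyclic_inj_def partial_inj_def)
    moreover have "R = insert (v, v) f" using vv by (auto simp: f_def)
    moreover have "v \<in> V" using vv RV by blast
    ultimately show ?thesis unfolding R_def[symmetric] loop_only_inj_def by blast
  qed
qed

section \<open>Subgroups of a given size and labelled graphs\<close>

definition pointed_graphs :: "'a set \<Rightarrow> nat \<Rightarrow> (nat \<times> 'a \<times> nat) set set" where
  "pointed_graphs A n = {E. admissible A {..<n} E 0}"

lemma finite_pointed_graphs: "finite A \<Longrightarrow> finite (pointed_graphs A n)"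
proof (rule finite_subset)
  show "pointed_graphs A n \<subseteq> Pow ({..<n} \<times> A \<times> {..<n})"
    by (auto simp: pointed_graphs_def admissible_def A_graph_def)
qed auto

text \<open>
  Any Stallings graph of size \<open>n\<close> can be relabelled so that its base point becomes
  \<open>0\<close>.
\<close>

lemma subgroups_of_size_eq:
  "subgroups_of_size A n = (\<lambda>E. loop_group A E 0) ` pointed_graphs A n"
proof (intro equalityI subsetI)
  fix H assume "H \<in> subgroups_of_size A n"
  then obtain V :: "nat set" and E p where fg: "fin_gen_subgroup (free_group A) H"
    and st: "stallings_graph A H V E p" and cV: "card V = n"
    by (auto simp: subgroups_of_size_def)
  have adm: "admissible A V E p" using st by (simp add: stallings_graph_def)
  then have V: "finite V" "p \<in> V" and EV: "E \<subseteq> V \<times> A \<times> V" by (auto simp: admissible_def A_graph_def)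
  have n: "n > 0" using V cV card_gt_0_iff by blast
  have "H \<subseteq> carrier (free_group A)"
    using fg subgroup.subset by (auto simp: fin_gen_subgroup_def)
  then have H: "H = loop_group A E p"
    using st by (auto simp: stallings_graph_def loop_group_def)
  have "card (V - {p}) = card {1..<n}" using V cV by simp
  then obtain f where f: "bij_betw f (V - {p}) {1..<n}"
    using finite_same_card_bij[of "V - {p}" "{1..<n}"] V by auto
  define h where "h = f(p := 0)"
  have "bij_betw h (V - {p}) {1..<n} \<longleftrightarrow> bij_betw f (V - {p}) {1..<n}"
    by (rule bij_betw_cong) (simp add: h_def)
  then have fh: "bij_betw h (V - {p}) {1..<n}" using f by blast
  have bij: "bij_betw h ((V - {p}) \<union> {p}) ({1..<n} \<union> {h p})"
    by (rule notIn_Un_bij_betw[OF _ _ fh]) (simp_all add: h_def)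
  have "(V - {p}) \<union> {p} = V" "{1..<n} \<union> {h p} = {..<n}"
    using V n by (auto simp: h_def)
  with bij have "bij_betw h V {..<n}" by (simp only:)
  then have h: "inj_on h V" "h ` V = {..<n}" "h p = 0"
    by (simp_all add: bij_betw_def h_def)
  have "relabel h E \<in> pointed_graphs A n"
    using admissible_relabel[OF adm h(1)] h by (simp add: pointed_graphs_def)
  moreover have "loop_group A (relabel h E) 0 = H"
    using loop_group_relabel[OF EV h(1) V(2)] h(3) H by simp
  ultimately show "H \<in> (\<lambda>E. loop_group A E 0) ` pointed_graphs A n" by blast
next
  fix H assume "H \<in> (\<lambda>E. loop_group A E 0) ` pointed_graphs A n"
  then obtain E where E: "admissible A {..<n} E 0" "H = loop_group A E 0"
    by (auto simp: pointed_graphs_def)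
  have "stallings_graph A H {..<n} E 0"
    using E by (auto simp: stallings_graph_def loop_group_def)
  moreover have "card {..<n} = n" by simp
  ultimately have "\<exists>(V :: nat set) E p. stallings_graph A H V E p \<and> card V = n" by blast
  then show "H \<in> subgroups_of_size A n"
    using fin_gen_loop_group[OF E(1)] E(2) by (simp add: subgroups_of_size_def)
qed

text \<open>
  The permutations of \<open>{1..<n}\<close> act on the graphs defining a given subgroup,
  transitively by uniqueness of the Stallings graph and freely by rigidity.
\<close>

lemma card_labellings:
  assumes E0: "E0 \<in> pointed_graphs A n"
  shows "card {E \<in> pointed_graphs A n. loop_group A E 0 = loop_group A E0 0} = fact (n - 1)"
proof -
  let ?F = "{E \<in> pointed_graphs A n. loop_group A E 0 = loop_group A E0 0}"
  let ?P = "{\<pi>. \<pi> permutes {1..<n}}"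
  have adm: "admissible A {..<n} E0 0" using E0 by (simp add: pointed_graphs_def)
  then have EV: "E0 \<subseteq> {..<n} \<times> A \<times> {..<n}" and n: "0 < n" by (auto simp: admissible_def A_graph_def)
  have perm: "inj_on \<pi> {..<n}" "\<pi> ` {..<n} = {..<n}" "\<pi> 0 = 0" if "\<pi> permutes {1..<n}" for \<pi>
  proof -
    have "\<pi> permutes {..<n}" using that by (rule permutes_subset) auto
    then show "inj_on \<pi> {..<n}" "\<pi> ` {..<n} = {..<n}" by (simp_all add: permutes_inj_on permutes_image)
    show "\<pi> 0 = 0" using that by (rule permutes_not_in) simp
  qed
  have "inj_on (\<lambda>\<pi>. relabel \<pi> E0) ?P"
  proof (rule inj_onI)
    fix \<pi> \<tau> assume p: "\<pi> \<in> ?P" "\<tau> \<in> ?P" and eq: "relabel \<pi> E0 = relabel \<tau> E0"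
    have pp: "\<pi> permutes {1..<n}" "\<tau> permutes {1..<n}" using p by auto
    show "\<pi> = \<tau>"
    proof
      fix v
      show "\<pi> v = \<tau> v"
      proof (cases "v < n")
        case True
        have "\<pi> 0 = \<tau> 0" using perm(3)[OF pp(1)] perm(3)[OF pp(2)] by simp
        then show ?thesis using relabel_rigid[OF adm eq _ perm(1)[OF pp(1)]] True by blast
      next
        case False
        then have "v \<notin> {1..<n}" by simp
        then show ?thesis using permutes_not_in[OF pp(1)] permutes_not_in[OF pp(2)] by metis
      qed
    qed
  qed
  moreover have "(\<lambda>\<pi>. relabel \<pi> E0) ` ?P = ?F"
  proof (intro equalityI subsetI)
    fix E assume "E \<in> (\<lambda>\<pi>. relabel \<pi> E0) ` ?P"
    then obtain \<pi> where \<pi>: "\<pi> permutes {1..<n}" "E = relabel \<pi> E0" by blast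
    have "admissible A {..<n} E 0"
      using admissible_relabel[OF adm perm(1)[OF \<pi>(1)]] perm[OF \<pi>(1)] \<pi>(2) by simp
    moreover have "loop_group A E 0 = loop_group A E0 0"
      using loop_group_relabel[OF EV perm(1)[OF \<pi>(1)], of 0] n perm(3)[OF \<pi>(1)] \<pi>(2) by simp
    ultimately show "E \<in> ?F" by (simp add: pointed_graphs_def)
  next
    fix E assume "E \<in> ?F"
    then have admE: "admissible A {..<n} E 0" and eq: "loop_group A E0 0 = loop_group A E 0"
      by (auto simp: pointed_graphs_def)
    obtain h where h: "bij_betw h {..<n} {..<n}" "h 0 = 0" "E = relabel h E0"
      using stallings_graph_unique[OF adm admE eq] by blast
    define \<pi> where "\<pi> v = (if v \<in> {1..<n} then h v else v)" for v
    have ph: "\<pi> v = h v" if "v \<in> {..<n}" for v using that h(2) by (cases "v = 0") (auto simp: \<pi>_def)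
    have "bij_betw h ({..<n} - {0}) ({..<n} - {h 0})"
      using h n by (intro bij_betw_DiffI) auto
    moreover have "{..<n} - {0} = {1..<n}" by auto
    ultimately have "bij_betw h {1..<n} {1..<n}" using h(2) by simp
    moreover have "bij_betw \<pi> {1..<n} {1..<n} \<longleftrightarrow> bij_betw h {1..<n} {1..<n}"
      by (rule bij_betw_cong) (simp add: \<pi>_def)
    ultimately have "bij_betw \<pi> {1..<n} {1..<n}" by blast
    then have "\<pi> permutes {1..<n}" by (rule bij_imp_permutes) (auto simp: \<pi>_def)
    moreover have "relabel \<pi> E0 = E" unfolding h(3) by (rule relabel_cong[OF EV ph])
    ultimately show "E \<in> (\<lambda>\<pi>. relabel \<pi> E0) ` ?P" by blast
  qed
  ultimately have "card ?F = card ?P" using card_image by metis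
  then show ?thesis by (simp add: card_permutations)
qed

section \<open>A positive proportion of the families is admissible\<close>

definition graph_of :: "'a set \<Rightarrow> ('a \<Rightarrow> 'v rel) \<Rightarrow> ('v \<times> 'a \<times> 'v) set" where
  "graph_of A F = {(u, a, v). a \<in> A \<and> (u, v) \<in> F a}"

lemma not_leaf_graph_of:
  assumes fin: "finite (graph_of A F)" and ab: "a \<in> A" "b \<in> A" "a \<noteq> b"
    and ni: "\<not> (v \<notin> Field (F a) \<and> (v \<notin> Domain (F b) \<or> v \<notin> Range (F b)))"
      "\<not> (v \<notin> Field (F b) \<and> (v \<notin> Domain (F a) \<or> v \<notin> Range (F a)))"
  shows "\<not> leaf (graph_of A F) v"
proof -
  let ?E = "graph_of A F"
  let ?O = "{e \<in> ?E. fst e = v}" and ?I = "{e \<in> ?E. snd (snd e) = v}"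
  have f: "finite ?O" "finite ?I" using fin by simp_all
  have O1: "1 \<le> card ?O" if x: "v \<in> Domain (F x)" "x \<in> A" for x
  proof -
    obtain w where "(v, w) \<in> F x" using x by blast
    then have "{(v, x, w)} \<subseteq> ?O" using x by (simp add: graph_of_def)
    from card_mono[OF f(1) this] show ?thesis by simp
  qed
  have I1: "1 \<le> card ?I" if x: "v \<in> Range (F x)" "x \<in> A" for x
  proof -
    obtain w where "(w, v) \<in> F x" using x by blast
    then have "{(w, x, v)} \<subseteq> ?I" using x by (simp add: graph_of_def)
    from card_mono[OF f(2) this] show ?thesis by simp
  qed
  have O2: "2 \<le> card ?O" if x: "v \<in> Domain (F a)" "v \<in> Domain (F b)"
  proof -
    obtain w w' where "(v, w) \<in> F a" "(v, w') \<in> F b" using x by blast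
    then have "{(v, a, w), (v, b, w')} \<subseteq> ?O" using ab by (simp add: graph_of_def)
    from card_mono[OF f(1) this] show ?thesis using ab by simp
  qed
  have I2: "2 \<le> card ?I" if x: "v \<in> Range (F a)" "v \<in> Range (F b)"
  proof -
    obtain w w' where "(w, v) \<in> F a" "(w', v) \<in> F b" using x by blast
    then have "{(w, a, v), (w', b, v)} \<subseteq> ?I" using ab by (simp add: graph_of_def)
    from card_mono[OF f(2) this] show ?thesis using ab by simp
  qed
  have F: "v \<in> Field (F x) \<longleftrightarrow> v \<in> Domain (F x) \<or> v \<in> Range (F x)" for x by (simp add: Field_def)
  have "2 \<le> card ?O + card ?I"
  proof (cases "v \<in> Domain (F a) \<and> v \<in> Domain (F b) \<or> v \<in> Range (F a) \<and> v \<in> Range (F b)")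
    case True
    then show ?thesis using O2 I2 by linarith
  next
    case False
    then have "(v \<in> Domain (F a) \<or> v \<in> Domain (F b)) \<and> (v \<in> Range (F a) \<or> v \<in> Range (F b))"
      using ni unfolding F by blast
    then have "1 \<le> card ?O" "1 \<le> card ?I" using O1 I1 ab by blast+
    then show ?thesis by linarith
  qed
  then show ?thesis by (simp add: leaf_def)
qed

text \<open>
  Connectedness and the absence of leaves are inherited from the two letters \<open>a\<close> and
  \<open>b\<close>. The set \<open>S\<close> of vertices connected to a given one is a cut
  respected by all letters.
\<close>

lemma admissible_graph_of:
  assumes A: "finite A" "a \<in> A" "b \<in> A" "a \<noteq> b" and V: "finite V" "p \<in> V"
    and F: "\<And>c. c \<in> A \<Longrightarrow> F c \<in> partial_inj V" and good: "(F a, F b) \<notin> bad_pairs V"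
  shows "admissible A V (graph_of A F) p"
proof -
  let ?E = "graph_of A F"
  have sub: "?E \<subseteq> V \<times> A \<times> V" using F by (fastforce simp: graph_of_def partial_inj_def)
  have fin: "finite ?E" using sub A V finite_subset by (metis finite_SigmaI)
  have Fab: "F a \<in> partial_inj V" "F b \<in> partial_inj V" using F A by blast+
  have sv: "single_valued (F c)" "single_valued ((F c)\<inverse>)" if "c \<in> A" for c
    using F[OF that] by (simp_all add: partial_inj_def)
  have "A_graph A V ?E"
    unfolding A_graph_def
  proof (intro conjI allI impI sub)
    fix u c v v' assume "(u, c, v) \<in> ?E" "(u, c, v') \<in> ?E"
    then show "v = v'" using single_valuedD[OF sv(1)] by (auto simp: graph_of_def)
  next
    fix u u' c v assume "(u, c, v) \<in> ?E" "(u', c, v) \<in> ?E"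
    then show "u = u'" using single_valuedD[OF sv(2)] by (auto simp: graph_of_def)
  qed
  moreover have "connected_graph V ?E"
    unfolding connected_graph_def
  proof (intro ballI)
    fix u v assume uv: "u \<in> V" "v \<in> V"
    let ?X = "{(x, y). \<exists>a. (x, a, y) \<in> ?E \<or> (y, a, x) \<in> ?E}"
    define S where "S = {v \<in> V. (u, v) \<in> ?X\<^sup>*}"
    have cut: "respects_cut V S (F c)" if c: "c \<in> A" for c
      unfolding respects_cut_def
    proof
      fix e assume e: "e \<in> F c"
      obtain x y where xy: "e = (x, y)" by (cases e)
      have V': "x \<in> V" "y \<in> V" using F[OF c] e xy by (auto simp: partial_inj_def)
      have "(x, y) \<in> ?X" "(y, x) \<in> ?X" using e c xy by (auto simp: graph_of_def)
      then have "(u, x) \<in> ?X\<^sup>* \<longleftrightarrow> (u, y) \<in> ?X\<^sup>*" by (meson rtrancl.rtrancl_into_rtrancl)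
      then show "e \<in> S \<times> S \<union> (V - S) \<times> (V - S)" using V' by (simp add: S_def xy)
    qed
    have "u \<in> S" "S \<subseteq> V" using uv by (auto simp: S_def)
    have "S = V"
    proof (rule ccontr)
      assume "S \<noteq> V"
      then have "(F a, F b) \<in> cut_pairs V"
        unfolding cut_pairs_def using Fab \<open>u \<in> S\<close> \<open>S \<subseteq> V\<close> cut A by blast
      then show False using good by (simp add: bad_pairs_def)
    qed
    then show "(u, v) \<in> ?X\<^sup>*" using uv by (auto simp: S_def)
  qed
  moreover have "\<not> leaf ?E v" if v: "v \<in> V" for v
  proof (rule not_leaf_graph_of[OF fin A(2-4)])
    show "\<not> (v \<notin> Field (F a) \<and> (v \<notin> Domain (F b) \<or> v \<notin> Range (F b)))"
      using good v Fab unfolding bad_pairs_def isolated_pairs_def by blast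
    show "\<not> (v \<notin> Field (F b) \<and> (v \<notin> Domain (F a) \<or> v \<notin> Range (F a)))"
      using good v Fab unfolding bad_pairs_def isolated_pairs_def by blast
  qed
  ultimately show ?thesis using V fin by (simp add: admissible_def)
qed

text \<open>
  The remaining coordinates are unconstrained.
\<close>

lemma card_PiE_pair_le:
  assumes A: "finite A" "a \<in> A" "b \<in> A" "a \<noteq> b" "card A = r" and X: "finite X" and B: "B \<subseteq> X \<times> X"
  shows "card {F \<in> A \<rightarrow>\<^sub>E X. (F a, F b) \<in> B} \<le> card B * card X ^ (r - 2)"
proof -
  let ?S = "{F \<in> A \<rightarrow>\<^sub>E X. (F a, F b) \<in> B}" and ?C = "A - {a, b}"
  let ?k = "\<lambda>F. ((F a, F b), restrict F ?C)"
  have "inj_on ?k ?S"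
  proof (rule inj_onI)
    fix F G assume FG: "F \<in> ?S" "G \<in> ?S" "?k F = ?k G"
    show "F = G"
    proof (rule PiE_ext)
      show "F \<in> A \<rightarrow>\<^sub>E X" "G \<in> A \<rightarrow>\<^sub>E X" using FG by auto
      fix c assume c: "c \<in> A"
      show "F c = G c"
      proof (cases "c = a \<or> c = b")
        case False
        have "restrict F ?C c = restrict G ?C c" using FG(3) by (metis snd_conv)
        then show ?thesis using c False by simp
      qed (use FG(3) in auto)
    qed
  qed
  moreover have "?k ` ?S \<subseteq> B \<times> (?C \<rightarrow>\<^sub>E X)" by (auto simp: PiE_def)
  moreover have "finite B" using B X finite_subset by blast
  then have "finite (B \<times> (?C \<rightarrow>\<^sub>E X))" using A X by (intro finite_cartesian_product finite_PiE) auto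
  ultimately have "card ?S \<le> card (B \<times> (?C \<rightarrow>\<^sub>E X))" by (rule card_inj_on_le)
  also have "\<dots> = card B * card X ^ (r - 2)"
  proof -
    have "card ?C = r - 2" using A by (simp add: card_Diff_subset numeral_2_eq_2)
    then show ?thesis using A by (simp only: card_cartesian_product card_PiE[OF finite_Diff] prod_constant)
  qed
  finally show ?thesis .
qed

lemma card_pointed_graphs_ge:
  assumes A: "finite A" "card A = r" "r \<ge> 2" and n: "n > 0"
    and bad: "real (card (bad_pairs {..<n})) \<le> real (card (partial_inj {..<n})) ^ 2 / 2"
  shows "real (card (partial_inj {..<n})) ^ r / 2 \<le> real (card (pointed_graphs A n))"
proof -
  obtain a b where ab: "a \<in> A" "b \<in> A" "a \<noteq> b"
  proof -
    obtain a where a: "a \<in> A" using A by fastforce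
    have "card (A - {a}) > 0" using A a by simp
    then obtain b where "b \<in> A - {a}" by (metis card_gt_0_iff ex_in_conv)
    then show thesis using a that[of a b] by blast
  qed
  let ?P = "partial_inj {..<n}"
  let ?I = "real (card ?P)"
  have finP: "finite ?P" by (simp add: finite_partial_inj)
  have subB: "bad_pairs {..<n} \<subseteq> ?P \<times> ?P"
    by (auto simp: bad_pairs_def cut_pairs_def isolated_pairs_def)
  let ?all = "A \<rightarrow>\<^sub>E ?P"
  let ?bad = "{F \<in> ?all. (F a, F b) \<in> bad_pairs {..<n}}"
  have fin_all: "finite ?all" using A finP by (intro finite_PiE) auto
  have "inj_on (graph_of A) ?all"
  proof (rule inj_onI)
    fix F G assume FG: "F \<in> ?all" "G \<in> ?all" and eq: "graph_of A F = graph_of A G"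
    show "F = G"
    proof (rule PiE_ext[OF FG])
      fix c assume c: "c \<in> A"
      have "(x, y) \<in> F c \<longleftrightarrow> (x, c, y) \<in> graph_of A F" for x y using c by (simp add: graph_of_def)
      moreover have "(x, y) \<in> G c \<longleftrightarrow> (x, c, y) \<in> graph_of A G" for x y using c by (simp add: graph_of_def)
      ultimately show "F c = G c" unfolding eq by (intro equalityI subrelI) blast+
    qed
  qed
  then have "inj_on (graph_of A) (?all - ?bad)" by (rule inj_on_subset) blast
  moreover have "graph_of A ` (?all - ?bad) \<subseteq> pointed_graphs A n"
  proof
    fix E assume "E \<in> graph_of A ` (?all - ?bad)"
    then obtain F where F: "E = graph_of A F" "F \<in> ?all" "(F a, F b) \<notin> bad_pairs {..<n}" by blast
    have "admissible A {..<n} (graph_of A F) 0"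
      using F n by (intro admissible_graph_of[OF A(1) ab]) auto
    then show "E \<in> pointed_graphs A n" by (simp add: pointed_graphs_def F(1))
  qed
  ultimately have "card (?all - ?bad) \<le> card (pointed_graphs A n)"
    by (rule card_inj_on_le) (rule finite_pointed_graphs[OF A(1)])
  moreover have "card (?all - ?bad) = card ?all - card ?bad"
    using fin_all by (intro card_Diff_subset) (auto elim: finite_subset[rotated])
  moreover have "card ?all = card ?P ^ r" using A by (simp add: card_PiE)
  moreover have "card ?bad \<le> card (bad_pairs {..<n}) * card ?P ^ (r - 2)"
    by (rule card_PiE_pair_le[OF A(1) ab A(2) finP subB])
  ultimately have "card ?P ^ r \<le> card (pointed_graphs A n) + card (bad_pairs {..<n}) * card ?P ^ (r - 2)"
    by linarith
  then have "real (card ?P ^ r) \<le> real (card (pointed_graphs A n) + card (bad_pairs {..<n}) * card ?P ^ (r - 2))"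
    by (rule of_nat_mono)
  then have "?I ^ r \<le> real (card (pointed_graphs A n)) + real (card (bad_pairs {..<n})) * ?I ^ (r - 2)"
    by simp
  also have "real (card (bad_pairs {..<n})) * ?I ^ (r - 2) \<le> ?I ^ 2 / 2 * ?I ^ (r - 2)"
    by (intro mult_right_mono bad) simp
  also have "?I ^ 2 / 2 * ?I ^ (r - 2) = ?I ^ r / 2"
  proof -
    have "?I ^ r = ?I ^ (2 + (r - 2))" by (simp only: le_add_diff_inverse[OF A(3)])
    then show ?thesis by (simp only: power_add times_divide_eq_left)
  qed
  finally show ?thesis by simp
qed

section \<open>The probability of malnormality\<close>

lemma card_malnormal_pointed_graphs_le:
  assumes A: "finite A" "card A = r"
  shows "card {E \<in> pointed_graphs A n. malnormal (free_group A) (loop_group A E 0)}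
    \<le> card (loop_only_inj {..<n}) ^ r"
proof -
  let ?M = "{E \<in> pointed_graphs A n. malnormal (free_group A) (loop_group A E 0)}"
  let ?k = "\<lambda>E. restrict (letter_rel E) A"
  have "inj_on ?k ?M"
  proof (rule inj_onI)
    fix E E' assume E: "E \<in> ?M" "E' \<in> ?M" "?k E = ?k E'"
    have rel: "letter_rel E a = letter_rel E' a" if "a \<in> A" for a
      using fun_cong[OF E(3), of a] that by simp
    have sub: "E \<subseteq> UNIV \<times> A \<times> UNIV" "E' \<subseteq> UNIV \<times> A \<times> UNIV"
      using E(1,2) by (auto simp: pointed_graphs_def admissible_def A_graph_def)
    have mem: "(u, a, v) \<in> E \<longleftrightarrow> (u, a, v) \<in> E'" for u a v
    proof (cases "a \<in> A")
      case True
      then show ?thesis using rel[OF True] by (auto simp: letter_rel_def)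
    next
      case False
      then show ?thesis using sub by blast
    qed
    show "E = E'"
    proof (intro equalityI subsetI)
      fix e show "e \<in> E \<Longrightarrow> e \<in> E'" "e \<in> E' \<Longrightarrow> e \<in> E" using mem by (cases e, simp)+
    qed
  qed
  moreover have "?k ` ?M \<subseteq> A \<rightarrow>\<^sub>E loop_only_inj {..<n}"
    by (auto simp: pointed_graphs_def intro: letter_rel_loop_only)
  moreover have "finite (A \<rightarrow>\<^sub>E loop_only_inj {..<n} :: ('a \<Rightarrow> nat rel) set)"
    using A by (intro finite_PiE) (auto simp: loop_only_inj_def finite_acyclic_inj)
  ultimately have "card ?M \<le> card (A \<rightarrow>\<^sub>E loop_only_inj {..<n} :: ('a \<Rightarrow> nat rel) set)"
    by (rule card_inj_on_le)
  then show ?thesis using A by (simp add: card_PiE)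
qed

lemma card_uniform_fibres:
  assumes "finite X" "\<And>x. x \<in> X \<Longrightarrow> card {y \<in> X. f y = f x} = m"
  shows "card X = m * card (f ` X)"
proof -
  have "card X = (\<Sum>y\<in>f ` X. card {x \<in> X. f x = y})"
    using sum.image_gen[OF assms(1), of "\<lambda>_. 1::nat" f] by simp
  also have "\<dots> = (\<Sum>y\<in>f ` X. m)" using assms(2) by (intro sum.cong) auto
  finally show ?thesis by simp
qed

lemma prob_malnormal_eq:
  assumes A: "finite A" and ne: "pointed_graphs A n \<noteq> {}"
  shows "measure_pmf.prob (pmf_of_set (subgroups_of_size A n)) {H. malnormal (free_group A) H}
    = real (card {E \<in> pointed_graphs A n. malnormal (free_group A) (loop_group A E 0)})
      / real (card (pointed_graphs A n))"
proof -
  let ?X = "pointed_graphs A n" and ?f = "\<lambda>E. loop_group A E 0"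
  let ?M = "{H. malnormal (free_group A) H}"
  let ?Y = "{E \<in> ?X. malnormal (free_group A) (?f E)}"
  have finX: "finite ?X" by (rule finite_pointed_graphs[OF A])
  have cX: "card ?X = fact (n - 1) * card (?f ` ?X)"
    by (rule card_uniform_fibres[OF finX card_labellings])
  have cY: "card ?Y = fact (n - 1) * card (?f ` ?Y)"
  proof (rule card_uniform_fibres)
    fix E assume E: "E \<in> ?Y"
    then have "{y \<in> ?Y. ?f y = ?f E} = {y \<in> ?X. ?f y = ?f E}" by auto
    then show "card {y \<in> ?Y. ?f y = ?f E} = fact (n - 1)" using card_labellings[of E A n] E by simp
  qed (use finX in simp)
  have im: "?f ` ?X \<inter> ?M = ?f ` ?Y" by blast
  have "measure_pmf.prob (pmf_of_set (subgroups_of_size A n)) ?M = real (card (?f ` ?X \<inter> ?M)) / real (card (?f ` ?X))"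
    unfolding subgroups_of_size_eq by (rule measure_pmf_of_set) (use ne finX in auto)
  also have "\<dots> = real (card ?Y) / real (card ?X)"
    unfolding im cX cY by simp
  finally show ?thesis .
qed

lemma inverse_sqrt_power:
  assumes "n > 0"
  shows "(1 / sqrt (real n)) ^ r = real n powr (- (real r / 2))"
proof -
  have "sqrt (real n) ^ r = (real n powr (1 / 2)) powr real r"
    using assms by (simp add: powr_half_sqrt powr_realpow)
  also have "\<dots> = real n powr (real r / 2)" by (simp add: powr_powr)
  finally show ?thesis using assms by (simp add: power_one_over powr_minus divide_simps)
qed

text \<open>
  The constant \<open>2 * 2^r\<close>: a factor \<open>2\<close> because, for large
  \<open>n\<close>, at least half of the families of partial injections are admissible, and a
  factor \<open>2\<close> for each letter from \<open>card_loop_only_inj\<close>.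
\<close>

theorem corollary4p8:
  fixes A :: "'a set" and r :: nat
  assumes "finite A" and "card A = r" and "r \<ge> 2"
  shows "(\<lambda>n. measure_pmf.prob (pmf_of_set (subgroups_of_size A n))
                {H. malnormal (free_group A) H})
         \<in> O(\<lambda>n. real n powr (- (real r / 2)))"
proof (rule bigoI[where c = "2 * 2 ^ r"])
  have "\<forall>\<^sub>F n::nat in sequentially. n \<ge> 2" by (rule eventually_ge_at_top)
  with card_bad_pairs
  show "\<forall>\<^sub>F n in sequentially.
      norm (measure_pmf.prob (pmf_of_set (subgroups_of_size A n)) {H. malnormal (free_group A) H})
      \<le> 2 * 2 ^ r * norm (real n powr (- (real r / 2)))"
  proof eventually_elim
    case (elim n)
    let ?I = "real (card (partial_inj {..<n}))"
    let ?M = "{E \<in> pointed_graphs A n. malnormal (free_group A) (loop_group A E 0)}"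
    have n: "n > 0" using elim by simp
    have "?I > 0" using card_partial_inj[of "{..<n}" n] pinj_ratio_pos[of n] by simp
    have lower: "?I ^ r / 2 \<le> real (card (pointed_graphs A n))"
      by (rule card_pointed_graphs_ge[OF assms n elim(1)])
    have Ir: "?I ^ r / 2 > 0" using \<open>?I > 0\<close> by simp
    have ne: "pointed_graphs A n \<noteq> {}" 
    proof
      assume "pointed_graphs A n = {}"
      then show False using lower Ir by (simp only: card.empty)
    qed
    have "real (card ?M) \<le> real (card (loop_only_inj {..<n}) ^ r)"
      by (rule of_nat_mono[OF card_malnormal_pointed_graphs_le[OF assms(1,2)]])
    also have "\<dots> = real (card (loop_only_inj {..<n})) ^ r" by simp
    also have "\<dots> \<le> (2 / sqrt n * ?I) ^ r"
      using card_loop_only_inj[of "{..<n}" n] elim(2) by (intro power_mono) auto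
    finally have upper: "real (card ?M) \<le> (2 / sqrt n * ?I) ^ r" .
    have "real (card ?M) / real (card (pointed_graphs A n)) \<le> (2 / sqrt n * ?I) ^ r / (?I ^ r / 2)"
      using upper lower Ir by (intro frac_le) auto
    also have "\<dots> = 2 * 2 ^ r * (1 / sqrt n) ^ r"
      using \<open>?I > 0\<close> by (simp add: power_mult_distrib power_divide)
    also have "\<dots> = 2 * 2 ^ r * real n powr (- (real r / 2))"
      by (simp only: inverse_sqrt_power[OF n])
    finally show ?case
      by (simp add: prob_malnormal_eq[OF assms(1) ne])
  qed
qed

end
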